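(* Let $\mathcal{A}=\langle Q_{\mathcal A},\mathbb N\cup\mathbb T,\Delta_{\mathcal A},\mathcal R_{\mathcal A},\varphi_{\mathcal A}\rangle$ and $\mathcal{B}=\langle Q_{\mathcal B},\mathbb N\cup\mathbb T,\Delta_{\mathcal B},\mathcal R_{\mathcal B},\varphi_{\mathcal B}\rangle$ be (symbolic) level-synchronized tree automata. If the entailment-checking procedure $\mathsf{Entail}(\mathcal A,\mathcal B)$ described in the context terminates, then it returns true if and only if $\mathcal A \sqsubseteq_{\mathrm{sc}} \mathcal B$ (entailment up to scaling).
   Context: Trees. A perfect binary tree of height $n\in\mathbb N\cup\{0\}$ over a set of symbols $\Sigma$ is a map $T\colon\bigcup_{0\le i\le n}\{0,1\}^i\to\Sigma$; nodes $v$ with $|v|<n$ are internal with children $v.0,v.1$, nodes in $\{0,1\}^n$ are leaves. LSTAs. A (symbolic) level-synchronized tree automaton (LSTA) is a tuple $\mathcal A=\langle Q,\mathbb N\cup\mathbb T,\Delta,\mathcal R,\varphi\rangle$ where $Q$ is a finite set of states, $\mathcal R\subseteq Q$ is the set of root states, $\mathbb T$ is a set of terms built from complex constants and a set $\mathbb X$ of complex variables using function symbols of some fixed theory, and $\Delta$ is a finite set of transitions, each either internal $q\xrightarrow{f,C}(q_1,q_2)$ with $f\in\mathbb N$ or leaf $q\xrightarrow{f,C}()$ with $f\in\mathbb C\cup\mathbb T$, where $q,q_1,q_2\in Q$ and $C\subseteq\mathbb N$ is a finite set of choices. For a transition $\delta$ we write $\mathrm{top}(\delta)=q$, $\mathrm{sym}(\delta)=f$,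 $\ell(\delta)=C$, $\mathrm{left}(\delta)=q_1$, $\mathrm{right}(\delta)=q_2$, $\mathrm{bot}(\delta)=\{q_1,q_2\}$ (and $\mathrm{bot}(\delta)=\emptyset$ for leaf transitions). Distinct transitions with the same top state have disjoint choice sets. The global constraint $\varphi$ is a formula over $\mathbb X$. A run of $\mathcal A$ on a tree $T$ assigns to each node $v$ a transition $\rho(v)$ with symbol $T(v)$, which is internal with bottom $(\mathrm{top}(\rho(v.0)),\mathrm{top}(\rho(v.1)))$ if $v$ is internal and is a leaf transition if $v$ is a leaf. It is accepting if $\mathrm{top}(\rho(\epsilon))\in\mathcal R$ and for every level $i$, $\bigcap\{\ell(\rho(v))\mid v\in\{0,1\}^i\}\neq\emptyset$. $L(\mathcal A)$ is the set of trees with an accepting run. For a tree $T$ with terms at leaves and an assignment $\sigma$ of complex values to variables, $T[\sigma]$ substitutes and evaluates the terms; $r\cdot T$ multiplies all leaf values by $r$; $\mathrm{vars}(\cdot)$ denotes the free variables of an object. Entailment up to scaling. $\mathcal A\sqsubseteq_{\mathrm{sc}}\mathcal B$ iff for every $T_{\mathcal A}\in L(\mathcal A)$ and every $\sigma_{\mathcal A}\colon\mathrm{vars}(T_{\mathcal A})\to\mathbb C$ there exist $T_{\mathcal B}\in L(\mathcal B)$, $\sigma_{\mathcal B}\colon\mathrm{vars}(T_{\mathcal B})\setminus\mathrm{vars}(T_{\mathcal A})\to\mathbb C$ and $r\in\mathbb R\setminus\{0\}$ with $T_{\mathcal A}[\sigma_{\mathcal A}]=r\cdot T_{\mathcal B}[\sigma_{\mathcal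 A}\cup\sigma_{\mathcal B}]$. Feasible transition sets. For an LSTA $\mathcal C$ and a finite set of states $D=\{q_1,\dots,q_k\}$, $\mathrm{feas}(\mathcal C,D)$ is the set of all sets $\{\delta_1,\dots,\delta_k\}$ of transitions of $\mathcal C$ with $\mathrm{top}(\delta_i)=q_i$ for all $i$ and $\bigcap_i\ell(\delta_i)\neq\emptyset$. Procedure $\mathsf{FindAllMappings}(\Gamma_{\mathcal A},f)$, where $\Gamma_{\mathcal A}\subseteq\Delta_{\mathcal A}$ and $f$ maps the tops of $\Gamma_{\mathcal A}$ to subsets of $Q_{\mathcal B}$: let $P=\bigcup$ of the image of $f$, and $F'=\emptyset$. For each $\Gamma_{\mathcal B}\in\mathrm{feas}(\mathcal B,P)$: start with empty maps $f'$ (states of $\mathcal A$ to sets of states of $\mathcal B$) and $g'$ (terms to sets of terms); for each $\delta_{\mathcal A}\in\Gamma_{\mathcal A}$ and each $q\in f(\mathrm{top}(\delta_{\mathcal A}))$, let $\delta_{\mathcal B}$ be the unique transition of $\Gamma_{\mathcal B}$ with top $q$; if both are leaf transitions, add $\mathrm{sym}(\delta_{\mathcal B})$ to $g'(\mathrm{sym}(\delta_{\mathcal A}))$; else if both are internal with equal symbol, add $\mathrm{left}(\delta_{\mathcal B})$ to $f'(\mathrm{left}(\delta_{\mathcal A}))$ and $\mathrm{right}(\delta_{\mathcal B})$ to $f'(\mathrm{right}(\delta_{\mathcal A}))$; otherwise mark this $\Gamma_{\mathcal B}$ as failed and stop processing it. If not failed, add $(f',g')$ to $F'$. Return $F'$.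 Procedure $\mathsf{Entail}(\mathcal A,\mathcal B)$, with $\mathcal R_{\mathcal B}=\{r_1,\dots,r_k\}$: set $\mathit{processed}=\emptyset$ and $\mathit{workset}=\{(\{q\},\{(\{q\mapsto\{r_1\}\},\emptyset),\dots,(\{q\mapsto\{r_k\}\},\emptyset)\})\mid q\in\mathcal R_{\mathcal A}\}$. While $\mathit{workset}$ contains some $(D,F)$: remove it and add it to $\mathit{processed}$. If $D=\emptyset$: let $Y$ be the set of variables occurring in the keys $u_1$ of all entries $u_1\mapsto U_2$ of all $g$ with $(\emptyset,g)\in F$, together with $\mathrm{vars}(\varphi_{\mathcal A})$; let $Z$ be the variables occurring in the value sets $U_2$ of those entries together with $\mathrm{vars}(\varphi_{\mathcal B})$, minus $Y$; if the formula $\forall Y\colon\varphi_{\mathcal A}\Rightarrow\exists Z\colon\varphi_{\mathcal B}\wedge\bigvee_{(\emptyset,g)\in F}\exists r\in\mathbb R\setminus\{0\}\colon\bigwedge_{(u_1\mapsto U_2)\in g,\,u_2\in U_2}u_1=r\cdot u_2$ is not valid, return false. Otherwise (for $D\neq\emptyset$), for each $\Gamma_{\mathcal A}\in\mathrm{feas}(\mathcal A,D)$: let $D'=\bigcup_{\delta\in\Gamma_{\mathcal A}}\mathrm{bot}(\delta)$ and $F'=\bigcup_{(f,g)\in F}\{(f',g\uplus g')\mid(f',g')\in\mathsf{FindAllMappings}(\Gamma_{\mathcal A},f)\}$, where $(g\uplus g')(x)=g(x)\cup g'(x)$ for $x$ in the union of the domains; if $(D',F')\notin\mathit{processed}\cup\mathit{workset}$,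 insert it into $\mathit{workset}$. When the workset is empty, return true.
   Formalization: Entailment ranges over assignments satisfying φ_A, φ_B, their variables included; "entailment implies true" is shown only if no exploration of A from a root to the empty state set uses a feasible set mixing leaf and internal transitions. Without these changes the claim is false. *)

theory Defs
  imports Complex_Main
begin

section \<open>Terms and formulas of a theory over the complex numbers\<close>

datatype ('f, vars_trm: 'x) trm =
  Const complex
| Var 'x
| App 'f "('f, 'x) trm list"

datatype ('p, 'f, 'x) fm =
  Eq "('f, 'x) trm" "('f, 'x) trm"
| Pred 'p "('f, 'x) trm list"
| Neg "('p, 'f, 'x) fm"
| Conj "('p, 'f, 'x) fm" "('p, 'f, 'x) fm"
| Exist 'x "('p, 'f, 'x) fm"

text \<open>The fixed theory enters only through the meaning of its symbols. Symbols carry no arity: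
  they are interpreted on argument lists of every length.\<close>

record ('p, 'f) interp =
  fun_int :: "'f \<Rightarrow> complex list \<Rightarrow> complex"
  pred_int :: "'p \<Rightarrow> complex list \<Rightarrow> bool"

primrec eval :: "('p, 'f) interp \<Rightarrow> ('x \<Rightarrow> complex) \<Rightarrow> ('f, 'x) trm \<Rightarrow> complex" where
  "eval M \<sigma> (Const c) = c"
| "eval M \<sigma> (Var x) = \<sigma> x"
| "eval M \<sigma> (App f ts) = fun_int M f (map (eval M \<sigma>) ts)"

primrec vars_fm :: "('p, 'f, 'x) fm \<Rightarrow> 'x set" where
  "vars_fm (Eq s t) = vars_trm s \<union> vars_trm t"
| "vars_fm (Pred p ts) = (\<Union>t\<in>set ts. vars_trm t)"
| "vars_fm (Neg \<phi>) = vars_fm \<phi>"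
| "vars_fm (Conj \<phi> \<psi>) = vars_fm \<phi> \<union> vars_fm \<psi>"
| "vars_fm (Exist x \<phi>) = vars_fm \<phi> - {x}"

primrec sat :: "('p, 'f) interp \<Rightarrow> ('x \<Rightarrow> complex) \<Rightarrow> ('p, 'f, 'x) fm \<Rightarrow> bool" where
  "sat M \<sigma> (Eq s t) \<longleftrightarrow> eval M \<sigma> s = eval M \<sigma> t"
| "sat M \<sigma> (Pred p ts) \<longleftrightarrow> pred_int M p (map (eval M \<sigma>) ts)"
| "sat M \<sigma> (Neg \<phi>) \<longleftrightarrow> \<not> sat M \<sigma> \<phi>"
| "sat M \<sigma> (Conj \<phi> \<psi>) \<longleftrightarrow> sat M \<sigma> \<phi> \<and> sat M \<sigma> \<psi>"
| "sat M \<sigma> (Exist x \<phi>) \<longleftrightarrow> (\<exists>c. sat M (\<sigma>(x := c)) \<phi>)"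


section \<open>Perfect binary trees\<close>

text \<open>A node is the word of directions from the root, where \<^const>\<open>False\<close> stands for 0 (left) and
  \<^const>\<open>True\<close> for 1 (right). A tree is a map defined exactly on its nodes, so equal trees have
  equal heights.\<close>

type_synonym 'a tree = "bool list \<rightharpoonup> 'a"

definition perfect_tree :: "nat \<Rightarrow> 'a tree \<Rightarrow> bool" where
  "perfect_tree n T \<longleftrightarrow> dom T = {v. length v \<le> n}"

text \<open>Left summands are symbols of internal nodes, right summands are leaf values.\<close>

definition vars_tree :: "(nat + ('f, 'x) trm) tree \<Rightarrow> 'x set" where
  "vars_tree T = (\<Union>t\<in>{t. Inr t \<in> ran T}. vars_trm t)"

definition eval_tree ::
  "('p, 'f) interp \<Rightarrow> ('x \<Rightarrow> complex) \<Rightarrow> (nat + ('f, 'x) trm) tree \<Rightarrow> (nat + complex) tree" where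
  "eval_tree M \<sigma> T = (\<lambda>v. map_option (map_sum id (eval M \<sigma>)) (T v))"

definition scale_tree :: "real \<Rightarrow> (nat + complex) tree \<Rightarrow> (nat + complex) tree" where
  "scale_tree r T = (\<lambda>v. map_option (map_sum id (\<lambda>c. of_real r * c)) (T v))"


section \<open>Level-synchronized tree automata\<close>

datatype ('q, 't) transition =
  is_Internal: Internal (top_of: 'q) (int_sym: nat) (choices: "nat set") (left: 'q) (right: 'q)
| is_Leaf: Leaf (top_of: 'q) (leaf_sym: 't) (choices: "nat set")

fun sym_of :: "('q, 't) transition \<Rightarrow> nat + 't" where
  "sym_of (Internal q f C q1 q2) = Inl f"
| "sym_of (Leaf q t C) = Inr t"

fun bot_of :: "('q, 't) transition \<Rightarrow> 'q set" where
  "bot_of (Internal q f C q1 q2) = {q1, q2}"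
| "bot_of (Leaf q t C) = {}"

record ('q, 'p, 'f, 'x) lsta =
  states :: "'q set"
  transitions :: "('q, ('f, 'x) trm) transition set"
  roots :: "'q set"
  constraint :: "('p, 'f, 'x) fm"

definition is_lsta :: "('q, 'p, 'f, 'x) lsta \<Rightarrow> bool" where
  "is_lsta \<A> \<longleftrightarrow>
     finite (states \<A>) \<and> roots \<A> \<subseteq> states \<A> \<and> finite (transitions \<A>) \<and>
     (\<forall>\<delta>\<in>transitions \<A>. top_of \<delta> \<in> states \<A> \<and> bot_of \<delta> \<subseteq> states \<A> \<and> finite (choices \<delta>)) \<and>
     (\<forall>\<delta>\<in>transitions \<A>. \<forall>\<delta>'\<in>transitions \<A>.
        \<delta> \<noteq> \<delta>' \<longrightarrow> top_of \<delta> = top_of \<delta>' \<longrightarrow> choices \<delta> \<inter> choices \<delta>' = {})"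

text \<open>A run is a total function here, but only its values on the nodes of the tree matter.\<close>

definition is_run ::
  "('q, 'p, 'f, 'x) lsta \<Rightarrow> nat \<Rightarrow> (nat + ('f, 'x) trm) tree \<Rightarrow>
   (bool list \<Rightarrow> ('q, ('f, 'x) trm) transition) \<Rightarrow> bool" where
  "is_run \<A> n T \<rho> \<longleftrightarrow>
     (\<forall>v. length v \<le> n \<longrightarrow> \<rho> v \<in> transitions \<A> \<and> T v = Some (sym_of (\<rho> v))) \<and>
     (\<forall>v. length v < n \<longrightarrow> is_Internal (\<rho> v) \<and>
        left (\<rho> v) = top_of (\<rho> (v @ [False])) \<and> right (\<rho> v) = top_of (\<rho> (v @ [True]))) \<and>
     (\<forall>v. length v = n \<longrightarrow> is_Leaf (\<rho> v))"

definition accepting_run ::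
  "('q, 'p, 'f, 'x) lsta \<Rightarrow> nat \<Rightarrow> (bool list \<Rightarrow> ('q, ('f, 'x) trm) transition) \<Rightarrow> bool" where
  "accepting_run \<A> n \<rho> \<longleftrightarrow>
     top_of (\<rho> []) \<in> roots \<A> \<and>
     (\<forall>i\<le>n. (\<Inter>v\<in>{v. length v = i}. choices (\<rho> v)) \<noteq> {})"

definition language :: "('q, 'p, 'f, 'x) lsta \<Rightarrow> (nat + ('f, 'x) trm) tree set" where
  "language \<A> = {T. \<exists>n \<rho>. perfect_tree n T \<and> is_run \<A> n T \<rho> \<and> accepting_run \<A> n \<rho>}"

text \<open>The assignments of a symbolic automaton are those that satisfy its global constraint, so the
  variables of the constraint are assigned together with those of the tree. Assignments are total
  functions: values of variables that do not occur are irrelevant, and \<^const>\<open>override_on\<close> plays the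
  role of the union of two assignments with disjoint domains.\<close>

definition entails_sc ::
  "('p, 'f) interp \<Rightarrow> ('qa, 'p, 'f, 'x) lsta \<Rightarrow> ('qb, 'p, 'f, 'x) lsta \<Rightarrow> bool" where
  "entails_sc M \<A> \<B> \<longleftrightarrow>
     (\<forall>TA\<in>language \<A>. \<forall>\<sigma>A. sat M \<sigma>A (constraint \<A>) \<longrightarrow>
        (\<exists>TB\<in>language \<B>. \<exists>\<sigma>B. \<exists>r::real. r \<noteq> 0 \<and>
           (let VA = vars_tree TA \<union> vars_fm (constraint \<A>);
                VB = vars_tree TB \<union> vars_fm (constraint \<B>);
                \<sigma> = override_on \<sigma>A \<sigma>B (VB - VA)
            in sat M \<sigma> (constraint \<B>) \<and>
               eval_tree M \<sigma>A TA = scale_tree r (eval_tree M \<sigma> TB))))"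


section \<open>The entailment-checking procedure\<close>

definition feas ::
  "('q, 'p, 'f, 'x) lsta \<Rightarrow> 'q set \<Rightarrow> ('q, ('f, 'x) trm) transition set set" where
  "feas \<C> D =
     {d ` D | d. (\<forall>q\<in>D. d q \<in> transitions \<C> \<and> top_of (d q) = q) \<and>
                 (\<Inter>q\<in>D. choices (d q)) \<noteq> {}}"

text \<open>Starting from the empty map and adding \<open>b\<close> to the set stored at \<open>a\<close>, for every pair
  \<open>(a, b)\<close> in \<open>R\<close>, yields the following map.\<close>

definition map_of_rel :: "('a \<times> 'b) set \<Rightarrow> 'a \<rightharpoonup> 'b set" where
  "map_of_rel R = (\<lambda>a. if a \<in> Domain R then Some (R `` {a}) else None)"

definition map_union :: "('a \<rightharpoonup> 'b set) \<Rightarrow> ('a \<rightharpoonup> 'b set) \<Rightarrow> 'a \<rightharpoonup> 'b set" where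
  "map_union g g' = (\<lambda>a. case (g a, g' a) of
     (None, y) \<Rightarrow> y
   | (Some U, None) \<Rightarrow> Some U
   | (Some U, Some U') \<Rightarrow> Some (U \<union> U'))"

text \<open>The pairs of transitions that are compared for a given \<open>\<Gamma>B\<close>. If \<open>\<Gamma>B\<close> is feasible for the
  union of the image of \<open>f\<close>, every state in \<open>f (top_of \<delta>A)\<close> is the top of exactly one
  element of \<open>\<Gamma>B\<close>.\<close>

definition matched ::
  "('qa, 't) transition set \<Rightarrow> ('qa \<rightharpoonup> 'qb set) \<Rightarrow> ('qb, 't) transition set \<Rightarrow>
   (('qa, 't) transition \<times> ('qb, 't) transition) set" where
  "matched \<Gamma>A f \<Gamma>B =
     {(\<delta>A, \<delta>B). \<delta>A \<in> \<Gamma>A \<and> \<delta>B \<in> \<Gamma>B \<and> (\<exists>S. f (top_of \<delta>A) = Some S \<and> top_of \<delta>B \<in> S)}"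

definition compatible :: "('qa, 't) transition \<Rightarrow> ('qb, 't) transition \<Rightarrow> bool" where
  "compatible \<delta>A \<delta>B \<longleftrightarrow>
     is_Leaf \<delta>A \<and> is_Leaf \<delta>B \<or>
     is_Internal \<delta>A \<and> is_Internal \<delta>B \<and> int_sym \<delta>A = int_sym \<delta>B"

definition state_mapping ::
  "(('qa, 't) transition \<times> ('qb, 't) transition) set \<Rightarrow> 'qa \<rightharpoonup> 'qb set" where
  "state_mapping X = map_of_rel
     ({(left \<delta>A, left \<delta>B) | \<delta>A \<delta>B. (\<delta>A, \<delta>B) \<in> X \<and> is_Internal \<delta>A} \<union>
      {(right \<delta>A, right \<delta>B) | \<delta>A \<delta>B. (\<delta>A, \<delta>B) \<in> X \<and> is_Internal \<delta>A})"

definition term_mapping ::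
  "(('qa, 't) transition \<times> ('qb, 't) transition) set \<Rightarrow> 't \<rightharpoonup> 't set" where
  "term_mapping X = map_of_rel
     {(leaf_sym \<delta>A, leaf_sym \<delta>B) | \<delta>A \<delta>B. (\<delta>A, \<delta>B) \<in> X \<and> is_Leaf \<delta>A}"

type_synonym ('qa, 'qb, 't) mappings = "(('qa \<rightharpoonup> 'qb set) \<times> ('t \<rightharpoonup> 't set)) set"

definition find_all_mappings ::
  "('qb, 'p, 'f, 'x) lsta \<Rightarrow> ('qa, ('f, 'x) trm) transition set \<Rightarrow> ('qa \<rightharpoonup> 'qb set) \<Rightarrow>
   ('qa, 'qb, ('f, 'x) trm) mappings" where
  "find_all_mappings \<B> \<Gamma>A f =
     {(state_mapping (matched \<Gamma>A f \<Gamma>B), term_mapping (matched \<Gamma>A f \<Gamma>B)) | \<Gamma>B.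
        \<Gamma>B \<in> feas \<B> (\<Union>(ran f)) \<and>
        (\<forall>(\<delta>A, \<delta>B)\<in>matched \<Gamma>A f \<Gamma>B. compatible \<delta>A \<delta>B)}"

text \<open>Validity of the formula tested for \<open>D = {}\<close>. All its free variables are bound by the
  quantifier over \<open>Y\<close> or the one over \<open>Z\<close>; the quantifier over \<open>Z\<close> is expressed by
  \<^const>\<open>override_on\<close>.\<close>

definition query_valid ::
  "('p, 'f) interp \<Rightarrow> ('qa, 'p, 'f, 'x) lsta \<Rightarrow> ('qb, 'p, 'f, 'x) lsta \<Rightarrow>
   ('qa, 'qb, ('f, 'x) trm) mappings \<Rightarrow> bool" where
  "query_valid M \<A> \<B> F \<longleftrightarrow>
     (let G = {g. (Map.empty, g) \<in> F};
          Y = (\<Union>g\<in>G. \<Union>u\<in>dom g. vars_trm u) \<union> vars_fm (constraint \<A>);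
          Z = ((\<Union>g\<in>G. \<Union>U\<in>ran g. \<Union>u\<in>U. vars_trm u) \<union> vars_fm (constraint \<B>)) - Y
      in \<forall>\<sigma>Y. sat M \<sigma>Y (constraint \<A>) \<longrightarrow>
           (\<exists>\<sigma>Z. let \<sigma> = override_on \<sigma>Y \<sigma>Z Z in
              sat M \<sigma> (constraint \<B>) \<and>
              (\<exists>g\<in>G. \<exists>r::real. r \<noteq> 0 \<and>
                 (\<forall>u1 U2. g u1 = Some U2 \<longrightarrow>
                    (\<forall>u2\<in>U2. eval M \<sigma> u1 = of_real r * eval M \<sigma> u2)))))"

definition successor ::
  "('qb, 'p, 'f, 'x) lsta \<Rightarrow> ('qa, 'qb, ('f, 'x) trm) mappings \<Rightarrow>
   ('qa, ('f, 'x) trm) transition set \<Rightarrow> 'qa set \<times> ('qa, 'qb, ('f, 'x) trm) mappings" where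
  "successor \<B> F \<Gamma>A =
     (\<Union>\<delta>\<in>\<Gamma>A. bot_of \<delta>,
      \<Union>(f, g)\<in>F. {(f', map_union g g') | f' g'. (f', g') \<in> find_all_mappings \<B> \<Gamma>A f})"

text \<open>\<open>entail_loop M \<A> \<B> processed workset res\<close> means that some execution of the loop from the
  given processed and work sets terminates and returns \<open>res\<close>. The element taken from the work set
  is chosen nondeterministically.\<close>

inductive entail_loop ::
  "('p, 'f) interp \<Rightarrow> ('qa, 'p, 'f, 'x) lsta \<Rightarrow> ('qb, 'p, 'f, 'x) lsta \<Rightarrow>
   ('qa set \<times> ('qa, 'qb, ('f, 'x) trm) mappings) set \<Rightarrow>
   ('qa set \<times> ('qa, 'qb, ('f, 'x) trm) mappings) set \<Rightarrow> bool \<Rightarrow> bool"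
  for M \<A> \<B> where
  finished: "entail_loop M \<A> \<B> processed {} True"
| refuted: "({}, F) \<in> workset \<Longrightarrow> \<not> query_valid M \<A> \<B> F \<Longrightarrow>
    entail_loop M \<A> \<B> processed workset False"
| confirmed: "({}, F) \<in> workset \<Longrightarrow> query_valid M \<A> \<B> F \<Longrightarrow>
    entail_loop M \<A> \<B> (insert ({}, F) processed) (workset - {({}, F)}) res \<Longrightarrow>
    entail_loop M \<A> \<B> processed workset res"
| expanded: "(D, F) \<in> workset \<Longrightarrow> D \<noteq> {} \<Longrightarrow>
    processed' = insert (D, F) processed \<Longrightarrow>
    workset' = (workset - {(D, F)}) \<union> (successor \<B> F ` feas \<A> D - processed') \<Longrightarrow>
    entail_loop M \<A> \<B> processed' workset' res \<Longrightarrow>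
    entail_loop M \<A> \<B> processed workset res"

definition entail_returns ::
  "('p, 'f) interp \<Rightarrow> ('qa, 'p, 'f, 'x) lsta \<Rightarrow> ('qb, 'p, 'f, 'x) lsta \<Rightarrow> bool \<Rightarrow> bool" where
  "entail_returns M \<A> \<B> res \<longleftrightarrow>
     entail_loop M \<A> \<B> {} {({q}, {([q \<mapsto> {r}], Map.empty) | r. r \<in> roots \<B>}) | q. q \<in> roots \<A>} res"


section \<open>Level-uniform automata\<close>

text \<open>The procedure explores an automaton level by level and also follows feasible sets that mix
  internal and leaf transitions, although no such set labels a level of a perfect tree. In a
  level-uniform automaton no exploration through a mixed set reaches the empty set of states.
  Without this property the procedure can return false for an automaton with empty language: take
  \<open>q \<rightarrow> (p, s)\<close> at the root, a leaf transition for \<open>p\<close> and \<open>s \<rightarrow> (p, p)\<close>, all three with the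
  same choice set.\<close>

definition level_step :: "('q, 'p, 'f, 'x) lsta \<Rightarrow> 'q set \<Rightarrow> 'q set \<Rightarrow> bool" where
  "level_step \<A> D D' \<longleftrightarrow> D \<noteq> {} \<and> (\<exists>\<Gamma>\<in>feas \<A> D. D' = (\<Union>\<delta>\<in>\<Gamma>. bot_of \<delta>))"

definition level_uniform :: "('q, 'p, 'f, 'x) lsta \<Rightarrow> bool" where
  "level_uniform \<A> \<longleftrightarrow>
     (\<forall>q\<in>roots \<A>. \<forall>D. \<forall>\<Gamma>\<in>feas \<A> D.
        (level_step \<A>)\<^sup>*\<^sup>* {q} D \<and> (level_step \<A>)\<^sup>*\<^sup>* (\<Union>\<delta>\<in>\<Gamma>. bot_of \<delta>) {} \<longrightarrow>
        (\<forall>\<delta>\<in>\<Gamma>. is_Internal \<delta>) \<or> (\<forall>\<delta>\<in>\<Gamma>. is_Leaf \<delta>))"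

end

theory Submission
  imports Defs
begin

text \<open>The transitions that an accepting run of \<open>\<A>\<close> uses on one level form a feasible set, since
  distinct transitions with a common top have disjoint choices. Along such a run the procedure
  computes in \<open>F\<close> exactly the mappings induced by the runs of \<open>\<B>\<close> that carry the same internal
  symbols: a state of \<open>\<A>\<close> is mapped to the states of \<open>\<B>\<close> at the same nodes, and at the leaves a
  term of \<open>\<A>\<close> to the terms of \<open>\<B>\<close> at the same leaves. Hence the query at the end of the run is
  entailment for the tree of the run. If the procedure returns true, every run of \<open>\<A>\<close> has been
  followed to its query. If it returns false, a failing query has been reached, and level uniformity
  makes the path to it the sequence of levels of a run of \<open>\<A>\<close>.\<close>

section \<open>Runs level by level\<close>

definition level :: "nat \<Rightarrow> bool list set" where
  "level i = {v. length v = i}"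

text \<open>The state that the transition at the parent demands at \<open>v\<close>. It depends only
  on levels strictly above \<open>v\<close>, so the states of a level are known before its
  transitions are chosen.\<close>

definition state_at :: "'q \<Rightarrow> (bool list \<Rightarrow> ('q, 't) transition) \<Rightarrow> bool list \<Rightarrow> 'q" where
  "state_at q \<rho> v =
     (if v = [] then q else if last v then right (\<rho> (butlast v)) else left (\<rho> (butlast v)))"

text \<open>Each node is checked against its parent rather than its children, so that a run can be
  built downwards, one level at a time.\<close>

definition level_ok ::
  "('q, 'p, 'f, 'x) lsta \<Rightarrow> 'q \<Rightarrow> (bool list \<Rightarrow> ('q, ('f, 'x) trm) transition) \<Rightarrow> nat \<Rightarrow> bool" where
  "level_ok \<C> q \<rho> i \<longleftrightarrow>
     (\<forall>v\<in>level i. \<rho> v \<in> transitions \<C> \<and> top_of (\<rho> v) = state_at q \<rho> v) \<and>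
     (\<Inter>v\<in>level i. choices (\<rho> v)) \<noteq> {}"

definition full_run ::
  "('q, 'p, 'f, 'x) lsta \<Rightarrow> 'q \<Rightarrow> (bool list \<Rightarrow> ('q, ('f, 'x) trm) transition) \<Rightarrow> nat \<Rightarrow> bool" where
  "full_run \<C> q \<rho> n \<longleftrightarrow> (\<forall>j\<le>n. level_ok \<C> q \<rho> j) \<and>
     (\<forall>v. length v < n \<longrightarrow> is_Internal (\<rho> v)) \<and> (\<forall>v. length v = n \<longrightarrow> is_Leaf (\<rho> v))"

definition run_tree :: "(bool list \<Rightarrow> ('q, 't) transition) \<Rightarrow> nat \<Rightarrow> (nat + 't) tree" where
  "run_tree \<rho> n = (\<lambda>v. if length v \<le> n then Some (sym_of (\<rho> v)) else None)"

section \<open>Levels and the states on them\<close>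

lemma level_iff [simp]: "v \<in> level i \<longleftrightarrow> length v = i"
  by (simp add: level_def)

lemma level_0: "level 0 = {[]}"
  by (auto simp: level_def)

lemma level_nonempty: "level i \<noteq> {}"
  using length_replicate[of i False] by (metis empty_iff level_iff)

lemma level_Suc: "level (Suc i) = (\<lambda>v. v @ [False]) ` level i \<union> (\<lambda>v. v @ [True]) ` level i"
proof -
  have "v \<in> (\<lambda>v. v @ [False]) ` level i \<union> (\<lambda>v. v @ [True]) ` level i"
    if len: "length v = Suc i" for v
  proof -
    obtain u b where "v = u @ [b]" "length u = i"
      using len by (cases v rule: rev_cases) auto
    then show ?thesis by (cases b) auto
  qed
  then show ?thesis by (intro equalityI subsetI) auto
qed

lemma state_at_Nil [simp]: "state_at q \<rho> [] = q"
  and state_at_snoc [simp]: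
    "state_at q \<rho> (v @ [b]) = (if b then right (\<rho> v) else left (\<rho> v))"
  by (simp_all add: state_at_def)

lemma state_at_cong:
  assumes "\<And>u. length u < i \<Longrightarrow> \<rho>' u = \<rho> u" and "length v \<le> i"
  shows "state_at q \<rho>' v = state_at q \<rho> v"
  using assms by (cases v rule: rev_cases) auto

lemma level_ok_cong:
  assumes "\<And>u. length u \<le> i \<Longrightarrow> \<rho>' u = \<rho> u"
  shows "level_ok \<C> q \<rho>' i = level_ok \<C> q \<rho> i"
proof -
  have "state_at q \<rho>' v = state_at q \<rho> v" if "length v = i" for v
    using state_at_cong[of i \<rho>' \<rho> v q] assms that by simp
  then show ?thesis using assms by (auto simp: level_ok_def)
qed

text \<open>All nodes of a level share a choice, whereas distinct transitions with a common top have
  disjoint choices. So the transitions of a level are a function of its states.\<close>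

lemma level_ok_eq:
  assumes "is_lsta \<C>" "level_ok \<C> q \<rho> i" "length u = i" "length v = i"
    and "state_at q \<rho> u = state_at q \<rho> v"
  shows "\<rho> u = \<rho> v"
proof (rule ccontr)
  assume "\<rho> u \<noteq> \<rho> v"
  then have "choices (\<rho> u) \<inter> choices (\<rho> v) = {}"
    using assms by (simp add: level_ok_def is_lsta_def)
  moreover obtain c where "\<And>w. length w = i \<Longrightarrow> c \<in> choices (\<rho> w)"
    using assms(2) unfolding level_ok_def by fastforce
  ultimately show False using assms(3,4) by blast
qed

text \<open>A selection of transitions by state can be copied to all nodes of the level; conversely,
  \<open>level_ok_eq\<close> makes the transitions of a level a selection by state. Choosing a
  feasible set is thus extending a run by one level.\<close>

lemma feas_iff_level:
  assumes "is_lsta \<C>"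
  shows "\<Gamma> \<in> feas \<C> (state_at q \<rho> ` level i) \<longleftrightarrow>
    (\<exists>\<rho>'. (\<forall>v. length v < i \<longrightarrow> \<rho>' v = \<rho> v) \<and> level_ok \<C> q \<rho>' i \<and> \<Gamma> = \<rho>' ` level i)"
proof
  assume "\<Gamma> \<in> feas \<C> (state_at q \<rho> ` level i)"
  then obtain d where "\<Gamma> = d ` state_at q \<rho> ` level i \<and>
      (\<forall>p\<in>state_at q \<rho> ` level i. d p \<in> transitions \<C> \<and> top_of (d p) = p) \<and>
      (\<Inter>p\<in>state_at q \<rho> ` level i. choices (d p)) \<noteq> {}"
    unfolding feas_def mem_Collect_eq by (rule exE)
  then have d: "\<Gamma> = d ` state_at q \<rho> ` level i"
      "\<forall>p\<in>state_at q \<rho> ` level i. d p \<in> transitions \<C> \<and> top_of (d p) = p"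
      "(\<Inter>p\<in>state_at q \<rho> ` level i. choices (d p)) \<noteq> {}"
    by simp_all
  define \<rho>' where "\<rho>' v = (if length v = i then d (state_at q \<rho> v) else \<rho> v)" for v
  \<comment> \<open>Overwriting level \<open>i\<close> does not affect its states, which depend only
    on the levels above.\<close>
  have st: "state_at q \<rho>' v = state_at q \<rho> v" if "length v = i" for v
    by (rule state_at_cong[of i]) (use that in \<open>auto simp: \<rho>'_def\<close>)
  have "level_ok \<C> q \<rho>' i"
    using d(2,3) by (auto simp: level_ok_def st \<rho>'_def)
  moreover have "\<Gamma> = \<rho>' ` level i"
    by (auto simp: d(1) \<rho>'_def image_iff)
  ultimately show "\<exists>\<rho>'. (\<forall>v. length v < i \<longrightarrow> \<rho>' v = \<rho> v) \<and> level_ok \<C> q \<rho>' i \<and> \<Gamma> = \<rho>' ` level i"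
    by (intro exI[of _ \<rho>']) (auto simp: \<rho>'_def)
next
  assume "\<exists>\<rho>'. (\<forall>v. length v < i \<longrightarrow> \<rho>' v = \<rho> v) \<and> level_ok \<C> q \<rho>' i \<and> \<Gamma> = \<rho>' ` level i"
  then obtain \<rho>' where r: "\<And>v. length v < i \<Longrightarrow> \<rho>' v = \<rho> v" "level_ok \<C> q \<rho>' i" "\<Gamma> = \<rho>' ` level i"
    by blast
  have st: "state_at q \<rho> v = state_at q \<rho>' v" if "length v = i" for v
    using that r(1) by (metis state_at_cong order_refl)
  \<comment> \<open>Any node in state \<open>p\<close> will do: by \<open>level_ok_eq\<close> all of
    them carry the same transition.\<close>
  define d where "d p = \<rho>' (SOME v. length v = i \<and> state_at q \<rho>' v = p)" for p
  have d: "d (state_at q \<rho> v) = \<rho>' v" if "length v = i" for v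
  proof -
    have "\<exists>u. length u = i \<and> state_at q \<rho>' u = state_at q \<rho>' v"
      using that by blast
    from someI_ex[OF this] show ?thesis
      unfolding d_def st[OF that] using level_ok_eq[OF assms r(2)] that by blast
  qed
  have "\<Gamma> = d ` state_at q \<rho> ` level i"
    unfolding r(3) image_image by (intro image_cong) (auto simp: d)
  moreover have "\<forall>p\<in>state_at q \<rho> ` level i. d p \<in> transitions \<C> \<and> top_of (d p) = p"
    using r(2) d st by (auto simp: level_ok_def)
  moreover have "(\<Inter>p\<in>state_at q \<rho> ` level i. choices (d p)) \<noteq> {}"
    using r(2) d by (auto simp: level_ok_def)
  ultimately show "\<Gamma> \<in> feas \<C> (state_at q \<rho> ` level i)"
    unfolding feas_def mem_Collect_eq by (intro exI[of _ d] conjI)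
qed

text \<open>Passes from runs on a given tree to runs that determine their tree; \<open>q\<close> is
  the top of the root transition, and the condition on children becomes one on parents.\<close>

lemma language_iff:
  "T \<in> language \<C> \<longleftrightarrow> (\<exists>q\<in>roots \<C>. \<exists>\<rho> n. full_run \<C> q \<rho> n \<and> T = run_tree \<rho> n)"
proof
  assume "T \<in> language \<C>"
  then obtain n \<rho> where T: "perfect_tree n T" and run: "is_run \<C> n T \<rho>" and acc: "accepting_run \<C> n \<rho>"
    unfolding language_def by blast
  have st: "state_at (top_of (\<rho> [])) \<rho> v = top_of (\<rho> v)" if "length v \<le> n" for v
  proof (cases v rule: rev_cases)
    case (snoc u b)
    then have "length u < n" using that by simp
    then show ?thesis using run by (cases b) (auto simp: is_run_def snoc)
  qed simp
  have "full_run \<C> (top_of (\<rho> [])) \<rho> n"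
    using run acc by (auto simp: full_run_def level_ok_def is_run_def accepting_run_def st level_def)
  moreover have "T = run_tree \<rho> n"
  proof
    fix v show "T v = run_tree \<rho> n v"
      using T run by (cases "length v \<le> n") (auto simp: run_tree_def perfect_tree_def is_run_def)
  qed
  ultimately show "\<exists>q\<in>roots \<C>. \<exists>\<rho> n. full_run \<C> q \<rho> n \<and> T = run_tree \<rho> n"
    using acc by (auto simp: accepting_run_def)
next
  assume "\<exists>q\<in>roots \<C>. \<exists>\<rho> n. full_run \<C> q \<rho> n \<and> T = run_tree \<rho> n"
  then obtain q \<rho> n where q: "q \<in> roots \<C>" and run: "full_run \<C> q \<rho> n" and T: "T = run_tree \<rho> n"
    by blast
  have trans: "\<rho> v \<in> transitions \<C>" and top: "top_of (\<rho> v) = state_at q \<rho> v" if "length v \<le> n" for v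
    using run that by (auto simp: full_run_def level_ok_def)
  have "perfect_tree n T"
    by (auto simp: T perfect_tree_def run_tree_def dom_def)
  moreover have "is_run \<C> n T \<rho>"
    using run trans top by (auto simp: is_run_def T run_tree_def full_run_def)
  moreover have "accepting_run \<C> n \<rho>"
    using run q top[of "[]"] by (auto simp: accepting_run_def full_run_def level_ok_def level_def)
  ultimately show "T \<in> language \<C>"
    unfolding language_def by blast
qed


section \<open>The mappings computed along a run\<close>

text \<open>\<open>map_of_rel\<close> of such a relation is what the procedure stores: which values
  occur together survives, at which nodes is forgotten.\<close>

definition level_pairs ::
  "(bool list \<Rightarrow> 'a) \<Rightarrow> (bool list \<Rightarrow> 'b) \<Rightarrow> nat \<Rightarrow> ('a \<times> 'b) set" where
  "level_pairs \<alpha> \<beta> i = (\<lambda>v. (\<alpha> v, \<beta> v)) ` level i"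

text \<open>The object behind each element of \<open>F\<close> after \<open>i\<close> levels. The
  shape of \<open>\<rho>'\<close> is left to \<open>compatible\<close>, which copies it from
  \<open>\<rho>\<close>.\<close>

definition simulates ::
  "('qb, 'p, 'f, 'x) lsta \<Rightarrow> (bool list \<Rightarrow> ('qa, ('f, 'x) trm) transition) \<Rightarrow>
   'qb \<Rightarrow> (bool list \<Rightarrow> ('qb, ('f, 'x) trm) transition) \<Rightarrow> nat \<Rightarrow> bool" where
  "simulates \<B> \<rho> r \<rho>' i \<longleftrightarrow> r \<in> roots \<B> \<and> (\<forall>j<i. level_ok \<B> r \<rho>' j) \<and>
     (\<forall>v. length v < i \<longrightarrow> compatible (\<rho> v) (\<rho>' v))"

text \<open>The intended \<open>F\<close> before level \<open>i\<close> is processed. The term map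
  is empty because along a run all earlier levels are internal.\<close>

definition mappings_at ::
  "('qb, 'p, 'f, 'x) lsta \<Rightarrow> 'qa \<Rightarrow> (bool list \<Rightarrow> ('qa, ('f, 'x) trm) transition) \<Rightarrow> nat \<Rightarrow>
   ('qa, 'qb, ('f, 'x) trm) mappings" where
  "mappings_at \<B> q \<rho> i =
     {(map_of_rel (level_pairs (state_at q \<rho>) (state_at r \<rho>') i), Map.empty) | r \<rho>'.
        simulates \<B> \<rho> r \<rho>' i}"

text \<open>The intended \<open>F\<close> once the leaf level \<open>n\<close> is processed;
  \<open>Suc n\<close> includes level \<open>n\<close> itself in the simulation.\<close>

definition final_mappings ::
  "('qb, 'p, 'f, 'x) lsta \<Rightarrow> (bool list \<Rightarrow> ('qa, ('f, 'x) trm) transition) \<Rightarrow> nat \<Rightarrow>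
   ('qa, 'qb, ('f, 'x) trm) mappings" where
  "final_mappings \<B> \<rho> n =
     {(Map.empty, map_of_rel (level_pairs (\<lambda>v. leaf_sym (\<rho> v)) (\<lambda>v. leaf_sym (\<rho>' v)) n)) | r \<rho>'.
        simulates \<B> \<rho> r \<rho>' (Suc n)}"

section \<open>Relations on a level and the maps stored for them\<close>

lemma Union_ran_map_of_rel: "\<Union> (ran (map_of_rel R)) = Range R"
  by (auto simp: map_of_rel_def ran_def Domain_iff split: if_splits)

lemma map_of_rel_empty [simp]: "map_of_rel {} = Map.empty"
  by (auto simp: map_of_rel_def)

lemma Range_level_pairs: "Range (level_pairs \<alpha> \<beta> i) = \<beta> ` level i"
  by (force simp: level_pairs_def)

lemma map_union_empty [simp]: "map_union Map.empty g = g"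
  by (auto simp: map_union_def)

lemma level_pairs_cong:
  assumes "\<And>v. length v = i \<Longrightarrow> \<alpha>' v = \<alpha> v" "\<And>v. length v = i \<Longrightarrow> \<beta>' v = \<beta> v"
  shows "level_pairs \<alpha>' \<beta>' i = level_pairs \<alpha> \<beta> i"
  unfolding level_pairs_def using assms by (intro image_cong) auto

lemma mappings_at_cong:
  fixes \<B> :: "('qb, 'p, 'f, 'x) lsta"
  assumes "\<And>v. length v < i \<Longrightarrow> \<rho>' v = \<rho> v"
  shows "mappings_at \<B> q \<rho>' i = mappings_at \<B> q \<rho> i"
proof -
  have "level_pairs (state_at q \<rho>') \<beta> i = level_pairs (state_at q \<rho>) \<beta> i" for \<beta> :: "bool list \<Rightarrow> 'qb"
    using assms by (intro level_pairs_cong state_at_cong[of i]) auto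
  moreover have "simulates \<B> \<rho>' r \<beta> i = simulates \<B> \<rho> r \<beta> i" for r \<beta>
    using assms by (auto simp: simulates_def)
  ultimately show ?thesis by (simp add: mappings_at_def)
qed

lemma mappings_at_0:
  "mappings_at \<B> q \<rho> 0 = {([q \<mapsto> {r}], Map.empty) | r. r \<in> roots \<B>}"
proof -
  have "map_of_rel {(q, r)} = [q \<mapsto> {r}]" for r :: 'b
    by (auto simp: map_of_rel_def)
  then show ?thesis
    by (simp add: mappings_at_def level_pairs_def level_0 simulates_def)
qed

text \<open>\<open>matched\<close> compares transitions with related tops, and up to three nodes may
  be involved: \<open>u\<close> and \<open>w\<close> for the transitions, \<open>v\<close> for the
  relation of the tops. By \<open>level_ok_eq\<close> the transitions at \<open>u\<close> and
  \<open>w\<close> are those at \<open>v\<close>, so only pairs from a common node are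
  compared.\<close>

lemma matched_level:
  assumes "is_lsta \<A>" "is_lsta \<B>" "level_ok \<A> q \<rho> i" "level_ok \<B> r \<rho>' i"
  shows "matched (\<rho> ` level i) (map_of_rel (level_pairs (state_at q \<rho>) (state_at r \<rho>') i)) (\<rho>' ` level i)
    = level_pairs \<rho> \<rho>' i"
proof -
  have top: "top_of (\<rho> v) = state_at q \<rho> v" "top_of (\<rho>' v) = state_at r \<rho>' v" if "length v = i" for v
    using assms(3,4) that by (auto simp: level_ok_def)
  have "(\<rho> u, \<rho>' w) \<in> level_pairs \<rho> \<rho>' i"
    if "length u = i" "length w = i" "length v = i"
      "state_at q \<rho> v = state_at q \<rho> u" "state_at r \<rho>' v = state_at r \<rho>' w" for u v w
    using that level_ok_eq[OF assms(1,3)] level_ok_eq[OF assms(2,4)]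
    unfolding level_pairs_def by (metis (no_types, lifting) image_eqI level_iff)
  then have 1: "(\<rho> u, \<rho>' w) \<in> level_pairs \<rho> \<rho>' i"
    if "length u = i" "length w = i"
      "(state_at q \<rho> u, state_at r \<rho>' w) \<in> level_pairs (state_at q \<rho>) (state_at r \<rho>') i" for u w
    using that by (auto simp: level_pairs_def[of "state_at q \<rho>"])
  have 2: "(state_at q \<rho> v, state_at r \<rho>' v) \<in> level_pairs (state_at q \<rho>) (state_at r \<rho>') i"
    if "length v = i" for v
    using that by (auto simp: level_pairs_def)
  show ?thesis
  proof (intro set_eqI iffI)
    fix x assume "x \<in> matched (\<rho> ` level i)
      (map_of_rel (level_pairs (state_at q \<rho>) (state_at r \<rho>') i)) (\<rho>' ` level i)"
    then show "x \<in> level_pairs \<rho> \<rho>' i"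
      using 1 by (auto simp: matched_def map_of_rel_def top split: if_splits)
  next
    fix x assume "x \<in> level_pairs \<rho> \<rho>' i"
    then obtain v where "x = (\<rho> v, \<rho>' v)" "length v = i" by (auto simp: level_pairs_def)
    then show "x \<in> matched (\<rho> ` level i)
      (map_of_rel (level_pairs (state_at q \<rho>) (state_at r \<rho>') i)) (\<rho>' ` level i)"
      using 2 by (auto simp: matched_def map_of_rel_def top)
  qed
qed

text \<open>The states of \<open>\<B>\<close> in the image of the map are those on level
  \<open>i\<close> of \<open>\<beta>\<close>, so by \<open>feas_iff_level\<close> the sets tried by
  the procedure are the extensions of \<open>\<beta>\<close> by that level.\<close>

lemma find_all_mappings_level:
  assumes "is_lsta \<A>" "is_lsta \<B>" "level_ok \<A> q \<rho> i"
  shows "find_all_mappings \<B> (\<rho> ` level i)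
      (map_of_rel (level_pairs (state_at q \<rho>) (state_at r \<beta>) i)) =
    {(state_mapping (level_pairs \<rho> \<beta>' i), term_mapping (level_pairs \<rho> \<beta>' i)) | \<beta>'.
      (\<forall>v. length v < i \<longrightarrow> \<beta>' v = \<beta> v) \<and> level_ok \<B> r \<beta>' i \<and>
      (\<forall>v. length v = i \<longrightarrow> compatible (\<rho> v) (\<beta>' v))}" (is "_ = ?R")
proof -
  define f where "f = map_of_rel (level_pairs (state_at q \<rho>) (state_at r \<beta>) i)"
  have ran: "\<Union> (ran f) = state_at r \<beta> ` level i"
    by (simp add: f_def Union_ran_map_of_rel Range_level_pairs)
  \<comment> \<open>Extending \<open>\<beta>\<close> leaves the states on level \<open>i\<close>
    intact, so \<open>f\<close> is also the map of \<open>\<beta>'\<close> and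
    \<open>matched_level\<close> applies.\<close>
  have m: "matched (\<rho> ` level i) f (\<beta>' ` level i) = level_pairs \<rho> \<beta>' i"
    if "\<And>v. length v < i \<Longrightarrow> \<beta>' v = \<beta> v" "level_ok \<B> r \<beta>' i" for \<beta>'
  proof -
    have "level_pairs (state_at q \<rho>) (state_at r \<beta>) i = level_pairs (state_at q \<rho>) (state_at r \<beta>') i"
      by (rule level_pairs_cong) (use that(1) in \<open>auto intro!: state_at_cong[symmetric, of i]\<close>)
    then show ?thesis using matched_level[OF assms that(2)] by (simp add: f_def)
  qed
  have c: "(\<forall>(\<delta>, \<delta>')\<in>level_pairs \<rho> \<beta>' i. compatible \<delta> \<delta>') \<longleftrightarrow>
      (\<forall>v. length v = i \<longrightarrow> compatible (\<rho> v) (\<beta>' v))" for \<beta>'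
    by (auto simp: level_pairs_def)
  have "find_all_mappings \<B> (\<rho> ` level i) f = ?R"
    (is "?L = _")
  proof (intro set_eqI iffI)
    fix x assume "x \<in> ?L"
    then obtain \<Gamma> where \<Gamma>: "\<Gamma> \<in> feas \<B> (state_at r \<beta> ` level i)"
      "\<forall>(\<delta>, \<delta>')\<in>matched (\<rho> ` level i) f \<Gamma>. compatible \<delta> \<delta>'"
      "x = (state_mapping (matched (\<rho> ` level i) f \<Gamma>), term_mapping (matched (\<rho> ` level i) f \<Gamma>))"
      unfolding find_all_mappings_def ran by blast
    then obtain \<beta>' where "\<forall>v. length v < i \<longrightarrow> \<beta>' v = \<beta> v" "level_ok \<B> r \<beta>' i" "\<Gamma> = \<beta>' ` level i"
      unfolding feas_iff_level[OF assms(2)] by blast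
    with \<Gamma> m[of \<beta>'] c[of \<beta>'] show "x \<in> ?R" by auto
  next
    fix x assume "x \<in> ?R"
    then obtain \<beta>' where b: "x = (state_mapping (level_pairs \<rho> \<beta>' i), term_mapping (level_pairs \<rho> \<beta>' i))"
      "\<forall>v. length v < i \<longrightarrow> \<beta>' v = \<beta> v" "level_ok \<B> r \<beta>' i"
      "\<forall>v. length v = i \<longrightarrow> compatible (\<rho> v) (\<beta>' v)" by blast
    then have "\<beta>' ` level i \<in> feas \<B> (\<Union> (ran f))"
      unfolding ran feas_iff_level[OF assms(2)] by blast
    moreover have "matched (\<rho> ` level i) f (\<beta>' ` level i) = level_pairs \<rho> \<beta>' i"
      using b m by blast
    ultimately show "x \<in> ?L"
      unfolding find_all_mappings_def mem_Collect_eq using b(1,4) c[of \<beta>']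
      by (intro exI[of _ "\<beta>' ` level i"]) simp
  qed
  then show ?thesis by (simp add: f_def)
qed

lemma simulates_Suc:
  "simulates \<B> \<rho> r \<beta> (Suc i) \<longleftrightarrow> simulates \<B> \<rho> r \<beta> i \<and> level_ok \<B> r \<beta> i \<and>
     (\<forall>v. length v = i \<longrightarrow> compatible (\<rho> v) (\<beta> v))"
  by (auto simp: simulates_def less_Suc_eq)

lemma simulates_cong:
  assumes "\<And>v. length v < i \<Longrightarrow> \<beta>' v = \<beta> v"
  shows "simulates \<B> \<rho> r \<beta>' i = simulates \<B> \<rho> r \<beta> i"
proof -
  have "level_ok \<B> r \<beta>' j = level_ok \<B> r \<beta> j" if "j < i" for j
    using assms that by (intro level_ok_cong) auto
  then show ?thesis using assms by (auto simp: simulates_def)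
qed

text \<open>Extending a simulation by a compatible level gives a simulation of one more level, and
  each of the latter extends itself. As \<open>mappings_at\<close> records no terms,
  \<open>map_union\<close> returns the new term map.\<close>

lemma successor_level:
  assumes "is_lsta \<A>" "is_lsta \<B>" "level_ok \<A> q \<rho> i"
  shows "successor \<B> (mappings_at \<B> q \<rho> i) (\<rho> ` level i) =
    (\<Union>v\<in>level i. bot_of (\<rho> v),
     {(state_mapping (level_pairs \<rho> \<beta> i), term_mapping (level_pairs \<rho> \<beta> i)) | r \<beta>.
        simulates \<B> \<rho> r \<beta> (Suc i)})"
proof -
  have "(\<Union>(f, g)\<in>mappings_at \<B> q \<rho> i.
      {(f', map_union g g') | f' g'. (f', g') \<in> find_all_mappings \<B> (\<rho> ` level i) f}) =
    {x. \<exists>r \<beta>. simulates \<B> \<rho> r \<beta> i \<and> x \<in> find_all_mappings \<B> (\<rho> ` level i)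
      (map_of_rel (level_pairs (state_at q \<rho>) (state_at r \<beta>) i))}"
    by (fastforce simp: mappings_at_def)
  also have "\<dots> = {(state_mapping (level_pairs \<rho> \<beta> i), term_mapping (level_pairs \<rho> \<beta> i)) | r \<beta>.
        simulates \<B> \<rho> r \<beta> (Suc i)}"
    unfolding find_all_mappings_level[OF assms] simulates_Suc
    using simulates_cong[of i _ _ \<B> \<rho>] by blast
  finally show ?thesis by (simp add: successor_def)
qed

section \<open>Levels with one kind of transition\<close>

lemma leaf_not_internal: "is_Leaf \<delta> \<longleftrightarrow> \<not> is_Internal \<delta>"
  by (cases \<delta>) auto

text \<open>Discharges the filter on the kind of transition in \<open>state_mapping\<close> and
  \<open>term_mapping\<close> on a level where all transitions of \<open>\<rho>\<close> have that
  kind.\<close>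

lemma image_level_pairs:
  assumes "\<And>v. length v = i \<Longrightarrow> P (\<rho> v)"
  shows "{(h \<delta>, h' \<delta>') | \<delta> \<delta>'. (\<delta>, \<delta>') \<in> level_pairs \<rho> \<beta> i \<and> P \<delta>} =
    level_pairs (\<lambda>v. h (\<rho> v)) (\<lambda>v. h' (\<beta> v)) i"
proof (intro equalityI subsetI)
  fix x assume "x \<in> level_pairs (\<lambda>v. h (\<rho> v)) (\<lambda>v. h' (\<beta> v)) i"
  then obtain v where "x = (h (\<rho> v), h' (\<beta> v))" "length v = i"
    by (auto simp: level_pairs_def)
  moreover from this have "(\<rho> v, \<beta> v) \<in> level_pairs \<rho> \<beta> i"
    by (auto simp: level_pairs_def)
  ultimately show "x \<in> {(h \<delta>, h' \<delta>') | \<delta> \<delta>'. (\<delta>, \<delta>') \<in> level_pairs \<rho> \<beta> i \<and> P \<delta>}"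
    using assms by blast
qed (auto simp: level_pairs_def)

text \<open>The left and right pairs together are the pairs at the children of level
  \<open>i\<close>. The states \<open>q\<close> and \<open>r\<close> are arbitrary, since
  \<open>state_at\<close> uses them only at the root.\<close>

lemma state_mapping_internal:
  assumes "\<And>v. length v = i \<Longrightarrow> is_Internal (\<rho> v)"
  shows "state_mapping (level_pairs \<rho> \<beta> i) =
    map_of_rel (level_pairs (state_at q \<rho>) (state_at r \<beta>) (Suc i))"
proof -
  have "state_mapping (level_pairs \<rho> \<beta> i) = map_of_rel
      ((\<lambda>v. (left (\<rho> v), left (\<beta> v))) ` level i \<union> (\<lambda>v. (right (\<rho> v), right (\<beta> v))) ` level i)"
    unfolding state_mapping_def
    using image_level_pairs[of i is_Internal \<rho> left left \<beta>]
      image_level_pairs[of i is_Internal \<rho> right right \<beta>] assms by (simp add: level_pairs_def)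
  also have "(\<lambda>v. (left (\<rho> v), left (\<beta> v))) ` level i \<union> (\<lambda>v. (right (\<rho> v), right (\<beta> v))) ` level i
      = level_pairs (state_at q \<rho>) (state_at r \<beta>) (Suc i)"
    by (simp add: level_pairs_def level_Suc image_Un image_image)
  finally show ?thesis .
qed

lemma term_mapping_internal:
  assumes "\<And>v. length v = i \<Longrightarrow> is_Internal (\<rho> v)"
  shows "term_mapping (level_pairs \<rho> \<beta> i) = Map.empty"
proof -
  have none: "(\<delta>, \<delta>') \<in> level_pairs \<rho> \<beta> i \<and> is_Leaf \<delta> \<longleftrightarrow> False" for \<delta> \<delta>'
    using assms by (auto simp: level_pairs_def leaf_not_internal)
  show ?thesis unfolding term_mapping_def none by simp
qed

lemma state_mapping_leaf:
  assumes "\<And>v. length v = i \<Longrightarrow> is_Leaf (\<rho> v)"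
  shows "state_mapping (level_pairs \<rho> \<beta> i) = Map.empty"
proof -
  have none: "(\<delta>, \<delta>') \<in> level_pairs \<rho> \<beta> i \<and> is_Internal \<delta> \<longleftrightarrow> False" for \<delta> \<delta>'
    using assms by (auto simp: level_pairs_def leaf_not_internal)
  show ?thesis unfolding state_mapping_def none by simp
qed

lemma term_mapping_leaf:
  assumes "\<And>v. length v = i \<Longrightarrow> is_Leaf (\<rho> v)"
  shows "term_mapping (level_pairs \<rho> \<beta> i) =
    map_of_rel (level_pairs (\<lambda>v. leaf_sym (\<rho> v)) (\<lambda>v. leaf_sym (\<beta> v)) i)"
  unfolding term_mapping_def using image_level_pairs[of i is_Leaf \<rho> leaf_sym leaf_sym \<beta>] assms by simp

lemma bot_of_internal: "is_Internal \<delta> \<Longrightarrow> bot_of \<delta> = {left \<delta>, right \<delta>}"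
  by (cases \<delta>) auto

lemma bot_of_leaf: "is_Leaf \<delta> \<Longrightarrow> bot_of \<delta> = {}"
  by (cases \<delta>) auto

lemma bots_internal:
  assumes "\<And>v. length v = i \<Longrightarrow> is_Internal (\<rho> v)"
  shows "(\<Union>v\<in>level i. bot_of (\<rho> v)) = state_at q \<rho> ` level (Suc i)"
  using assms by (auto simp: level_Suc image_Un image_image bot_of_internal)

text \<open>The induction step for following a run through its internal levels, where no terms are
  recorded.\<close>

lemma successor_internal:
  fixes \<B> :: "('qb, 'p, 'f, 'x) lsta"
  assumes "is_lsta \<A>" "is_lsta \<B>" "level_ok \<A> q \<rho> i"
    and "\<And>v. length v = i \<Longrightarrow> is_Internal (\<rho> v)"
  shows "successor \<B> (mappings_at \<B> q \<rho> i) (\<rho> ` level i) =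
    (state_at q \<rho> ` level (Suc i), mappings_at \<B> q \<rho> (Suc i))"
proof -
  have "(state_mapping (level_pairs \<rho> \<beta> i), term_mapping (level_pairs \<rho> \<beta> i)) =
      (map_of_rel (level_pairs (state_at q \<rho>) (state_at r \<beta>) (Suc i)), Map.empty)"
    for r and \<beta> :: "bool list \<Rightarrow> ('qb, ('f, 'x) trm) transition"
    using state_mapping_internal[of i \<rho> \<beta> q r] term_mapping_internal[of i \<rho> \<beta>] assms(4) by simp
  then have "{(state_mapping (level_pairs \<rho> \<beta> i), term_mapping (level_pairs \<rho> \<beta> i)) | r \<beta>.
        simulates \<B> \<rho> r \<beta> (Suc i)} = mappings_at \<B> q \<rho> (Suc i)"
    unfolding mappings_at_def by (intro Collect_cong ex_cong1 arg_cong2[where f = "(\<and>)"]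
        arg_cong2[where f = "(=)"] refl)
  moreover have "(\<Union>v\<in>level i. bot_of (\<rho> v)) = state_at q \<rho> ` level (Suc i)"
    using assms(4) by (rule bots_internal)
  ultimately show ?thesis
    by (simp add: successor_level[OF assms(1-3)])
qed

text \<open>Ends the path of a run: leaf transitions have no bottom states and contribute only pairs
  of terms, which form the input of the query.\<close>

lemma successor_leaf:
  fixes \<B> :: "('qb, 'p, 'f, 'x) lsta"
  assumes "is_lsta \<A>" "is_lsta \<B>" "level_ok \<A> q \<rho> i"
    and "\<And>v. length v = i \<Longrightarrow> is_Leaf (\<rho> v)"
  shows "successor \<B> (mappings_at \<B> q \<rho> i) (\<rho> ` level i) = ({}, final_mappings \<B> \<rho> i)"
proof -
  have "(state_mapping (level_pairs \<rho> \<beta> i), term_mapping (level_pairs \<rho> \<beta> i)) =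
      (Map.empty, map_of_rel (level_pairs (\<lambda>v. leaf_sym (\<rho> v)) (\<lambda>v. leaf_sym (\<beta> v)) i))"
    for \<beta> :: "bool list \<Rightarrow> ('qb, ('f, 'x) trm) transition"
    using state_mapping_leaf[of i \<rho> \<beta>] term_mapping_leaf[of i \<rho> \<beta>] assms(4) by simp
  then have "{(state_mapping (level_pairs \<rho> \<beta> i), term_mapping (level_pairs \<rho> \<beta> i)) | r \<beta>.
        simulates \<B> \<rho> r \<beta> (Suc i)} = final_mappings \<B> \<rho> i"
    unfolding final_mappings_def by (intro Collect_cong ex_cong1 arg_cong2[where f = "(\<and>)"]
        arg_cong2[where f = "(=)"] refl)
  moreover have "(\<Union>v\<in>level i. bot_of (\<rho> v)) = {}"
    using assms(4) by (simp add: bot_of_leaf)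
  ultimately show ?thesis
    by (simp add: successor_level[OF assms(1-3)])
qed


section \<open>The query and entailment for a single tree\<close>

lemma eval_cong:
  "(\<And>x. x \<in> vars_trm t \<Longrightarrow> \<sigma> x = \<tau> x) \<Longrightarrow> eval M \<sigma> t = eval M \<tau> t"
proof (induction t)
  case (App f ts)
  then have "map (eval M \<sigma>) ts = map (eval M \<tau>) ts" by (intro map_cong) auto
  then show ?case by (simp only: eval.simps)
qed auto

lemma sat_cong:
  "(\<And>x. x \<in> vars_fm \<phi> \<Longrightarrow> \<sigma> x = \<tau> x) \<Longrightarrow> sat M \<sigma> \<phi> = sat M \<tau> \<phi>"
proof (induction \<phi> arbitrary: \<sigma> \<tau>)
  case (Eq s t)
  have "eval M \<sigma> s = eval M \<tau> s" "eval M \<sigma> t = eval M \<tau> t"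
    using Eq by (auto intro!: eval_cong)
  then show ?case by simp
next
  case (Pred p ts)
  then have "map (eval M \<sigma>) ts = map (eval M \<tau>) ts" by (intro map_cong eval_cong) auto
  then show ?case by (simp only: sat.simps)
next
  case (Neg \<phi>)
  have "sat M \<sigma> \<phi> = sat M \<tau> \<phi>"
    by (rule Neg.IH, rule Neg.prems) simp
  then show ?case by simp
next
  case (Conj \<phi> \<psi>)
  have "sat M \<sigma> \<phi> = sat M \<tau> \<phi>" "sat M \<sigma> \<psi> = sat M \<tau> \<psi>"
    by (rule Conj.IH, rule Conj.prems, simp)+
  then show ?case by simp
next
  case (Exist x \<phi>)
  have "sat M (\<sigma>(x := c)) \<phi> = sat M (\<tau>(x := c)) \<phi>" for c
  proof (rule Exist.IH)
    fix y assume "y \<in> vars_fm \<phi>"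
    then show "(\<sigma>(x := c)) y = (\<tau>(x := c)) y"
      using Exist.prems[of y] by simp
  qed
  then show ?case by simp
qed

text \<open>The body of \<open>entails_sc\<close> for one tree, isolated because it is compared with
  a single query.\<close>

definition entails_tree ::
  "('p, 'f) interp \<Rightarrow> ('qa, 'p, 'f, 'x) lsta \<Rightarrow> ('qb, 'p, 'f, 'x) lsta \<Rightarrow>
   (nat + ('f, 'x) trm) tree \<Rightarrow> bool" where
  "entails_tree M \<A> \<B> TA \<longleftrightarrow>
     (\<forall>\<sigma>A. sat M \<sigma>A (constraint \<A>) \<longrightarrow>
        (\<exists>TB\<in>language \<B>. \<exists>\<sigma>B. \<exists>r::real. r \<noteq> 0 \<and>
           (let VA = vars_tree TA \<union> vars_fm (constraint \<A>);
                VB = vars_tree TB \<union> vars_fm (constraint \<B>);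
                \<sigma> = override_on \<sigma>A \<sigma>B (VB - VA)
            in sat M \<sigma> (constraint \<B>) \<and>
               eval_tree M \<sigma>A TA = scale_tree r (eval_tree M \<sigma> TB))))"

lemma entails_sc_iff: "entails_sc M \<A> \<B> \<longleftrightarrow> (\<forall>TA\<in>language \<A>. entails_tree M \<A> \<B> TA)"
  by (simp add: entails_sc_def entails_tree_def)

section \<open>Trees read by runs\<close>

lemma vars_run_tree:
  assumes "full_run \<C> q \<rho> n"
  shows "vars_tree (run_tree \<rho> n) = (\<Union>v\<in>level n. vars_trm (leaf_sym (\<rho> v)))"
proof -
  have "Inr t \<in> ran (run_tree \<rho> n) \<longleftrightarrow> (\<exists>v\<in>level n. t = leaf_sym (\<rho> v))" (is "?L \<longleftrightarrow> ?R") for t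
  proof
    assume ?L
    then obtain v where v: "length v \<le> n" "sym_of (\<rho> v) = Inr t"
      by (auto simp: run_tree_def ran_def split: if_splits)
    then have "is_Leaf (\<rho> v)" "t = leaf_sym (\<rho> v)" by (cases "\<rho> v"; auto)+
    moreover have "length v = n"
      using v(1) calculation(1) assms by (auto simp: full_run_def leaf_not_internal le_less)
    ultimately show ?R by auto
  next
    assume ?R
    then obtain v where v: "length v = n" "t = leaf_sym (\<rho> v)" by auto
    then have "is_Leaf (\<rho> v)" using assms by (auto simp: full_run_def)
    then have "sym_of (\<rho> v) = Inr t" using v by (cases "\<rho> v") auto
    then have "run_tree \<rho> n v = Some (Inr t)" using v by (simp add: run_tree_def)
    then show ?L by (rule ranI)
  qed
  then show ?thesis by (auto simp: vars_tree_def)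
qed

lemma leaf_vars_run_tree:
  assumes "full_run \<C> q \<rho> n" "length v = n" "x \<in> vars_trm (leaf_sym (\<rho> v))"
  shows "x \<in> vars_tree (run_tree \<rho> n)"
  using assms by (auto simp: vars_run_tree)

text \<open>Identifies the test of the procedure: \<open>compatible\<close> is equality of symbols
  apart from the values of leaves.\<close>

lemma map_sum_sym_eq_iff:
  "map_sum id a (sym_of \<delta>) = map_sum id b (sym_of \<delta>') \<longleftrightarrow>
    compatible \<delta> \<delta>' \<and> (is_Leaf \<delta> \<longrightarrow> a (leaf_sym \<delta>) = b (leaf_sym \<delta>'))"
  by (cases \<delta>; cases \<delta>') (auto simp: compatible_def)

text \<open>A tree is a map whose domain is fixed by its height, so equality forces equal heights;
  then it is checked node by node, where only nodes of length \<open>n\<close> carry terms.\<close>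

lemma eval_run_tree_eq_iff:
  assumes "full_run \<A> q \<rho> n" "full_run \<B> r \<beta> m"
  shows "eval_tree M \<sigma> (run_tree \<rho> n) = scale_tree c (eval_tree M \<tau> (run_tree \<beta> m)) \<longleftrightarrow>
    n = m \<and> (\<forall>v. length v \<le> n \<longrightarrow> compatible (\<rho> v) (\<beta> v)) \<and>
    (\<forall>v. length v = n \<longrightarrow> eval M \<sigma> (leaf_sym (\<rho> v)) = of_real c * eval M \<tau> (leaf_sym (\<beta> v)))"
    (is "?S = ?T \<longleftrightarrow> _")
proof -
  have S: "?S v = (if length v \<le> n then Some (map_sum id (eval M \<sigma>) (sym_of (\<rho> v))) else None)" for v
    by (simp add: eval_tree_def run_tree_def)
  have T: "?T v = (if length v \<le> m then
      Some (map_sum id (\<lambda>t. of_real c * eval M \<tau> t) (sym_of (\<beta> v))) else None)" for v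
    by (simp add: eval_tree_def scale_tree_def run_tree_def sum.map_comp o_def id_def)
  have leaf: "is_Leaf (\<rho> v) \<longleftrightarrow> length v = n" if "length v \<le> n" for v
    using assms(1) that by (auto simp: full_run_def leaf_not_internal le_less)
  have "?S = ?T \<Longrightarrow> n = m"
  proof -
    assume eq: "?S = ?T"
    have "(length v \<le> n) = (length v \<le> m)" for v :: "bool list"
      using fun_cong[OF eq, of v] by (auto simp only: S T split: if_splits)
    then have "(k \<le> n) = (k \<le> m)" for k
      by (metis length_replicate)
    then show "n = m" by (meson le_antisym order_refl)
  qed
  moreover have "?S = ?T \<longleftrightarrow> (\<forall>v. length v \<le> n \<longrightarrow> compatible (\<rho> v) (\<beta> v)) \<and>
    (\<forall>v. length v = n \<longrightarrow> eval M \<sigma> (leaf_sym (\<rho> v)) = of_real c * eval M \<tau> (leaf_sym (\<beta> v)))"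
    if "n = m"
    unfolding fun_eq_iff S T using that leaf by (auto simp: map_sum_sym_eq_iff)
  ultimately show ?thesis by blast
qed

text \<open>\<open>compatible\<close> transfers the kind of each transition, so the shape that
  \<open>full_run\<close> demands of \<open>\<beta>\<close> follows from that of
  \<open>\<rho>\<close>.\<close>

lemma full_run_iff_simulates:
  assumes "full_run \<A> q \<rho> n"
  shows "simulates \<B> \<rho> r \<beta> (Suc n) \<longleftrightarrow>
    r \<in> roots \<B> \<and> full_run \<B> r \<beta> n \<and> (\<forall>v. length v \<le> n \<longrightarrow> compatible (\<rho> v) (\<beta> v))"
proof -
  have "full_run \<B> r \<beta> n \<longleftrightarrow> (\<forall>j\<le>n. level_ok \<B> r \<beta> j)"
    if "\<forall>v. length v \<le> n \<longrightarrow> compatible (\<rho> v) (\<beta> v)"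
  proof -
    have "is_Internal (\<beta> v) \<longleftrightarrow> is_Internal (\<rho> v)" if "length v \<le> n" for v
      using \<open>\<forall>v. _\<close> that by (auto simp: compatible_def leaf_not_internal)
    then show ?thesis using assms by (simp add: full_run_def leaf_not_internal)
  qed
  then show ?thesis by (auto simp: simulates_def less_Suc_eq_le)
qed

text \<open>The query ranges over stored pairs of terms, equality of trees over leaves; forgetting
  the nodes neither loses nor adds an equation.\<close>

lemma all_map_of_rel_level_pairs:
  "(\<forall>u U. map_of_rel (level_pairs \<alpha> \<beta> n) u = Some U \<longrightarrow> (\<forall>u'\<in>U. P u u')) \<longleftrightarrow>
    (\<forall>v. length v = n \<longrightarrow> P (\<alpha> v) (\<beta> v))"
proof -
  have "(\<forall>u U. map_of_rel R u = Some U \<longrightarrow> (\<forall>u'\<in>U. P u u')) \<longleftrightarrow> (\<forall>(u, u')\<in>R. P u u')" for R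
    by (auto simp: map_of_rel_def)
  then show ?thesis by (auto simp: level_pairs_def)
qed

lemma dom_level_pairs: "dom (map_of_rel (level_pairs \<alpha> \<beta> n)) = \<alpha> ` level n"
  by (force simp: map_of_rel_def level_pairs_def dom_def)

text \<open>Both sides reduce to a witness \<open>wit\<close>: a simulating run, a factor and an
  assignment. The query assigns all of \<open>Z\<close> before choosing a map, while entailment
  chooses the tree and reassigns only the variables new in it; the values of the surplus variables
  do not matter.\<close>

lemma query_valid_final:
  fixes \<A> :: "('qa, 'p, 'f, 'x) lsta" and \<B> :: "('qb, 'p, 'f, 'x) lsta"
  assumes "full_run \<A> q \<rho> n"
  shows "query_valid M \<A> \<B> (final_mappings \<B> \<rho> n) \<longleftrightarrow> entails_tree M \<A> \<B> (run_tree \<rho> n)"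
proof -
  define tm where "tm \<beta> = map_of_rel (level_pairs (\<lambda>v. leaf_sym (\<rho> v)) (\<lambda>v. leaf_sym (\<beta> v)) n)"
    for \<beta> :: "bool list \<Rightarrow> ('qb, ('f, 'x) trm) transition"
  define G where "G = {g. (Map.empty, g) \<in> final_mappings \<B> \<rho> n}"
  define Y where "Y = (\<Union>g\<in>G. \<Union>u\<in>dom g. vars_trm u) \<union> vars_fm (constraint \<A>)"
  define Z where "Z = ((\<Union>g\<in>G. \<Union>U\<in>ran g. \<Union>u\<in>U. vars_trm u) \<union> vars_fm (constraint \<B>)) - Y"
  define VA where "VA = vars_tree (run_tree \<rho> n) \<union> vars_fm (constraint \<A>)"
  define VB where "VB \<beta> = vars_tree (run_tree \<beta> n) \<union> vars_fm (constraint \<B>)"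
    for \<beta> :: "bool list \<Rightarrow> ('qb, ('f, 'x) trm) transition"
  have G_iff: "g \<in> G \<longleftrightarrow> (\<exists>r \<beta>. g = tm \<beta> \<and> simulates \<B> \<rho> r \<beta> (Suc n))" for g
    by (auto simp: G_def final_mappings_def tm_def)
  \<comment> \<open>If \<open>G\<close> is empty, \<open>Y\<close> may miss variables of the tree;
    but then no run simulates \<open>\<rho>\<close> and neither side has a witness.\<close>
  have Y_eq: "Y = VA" if "G \<noteq> {}"
  proof -
    have "dom g = (\<lambda>v. leaf_sym (\<rho> v)) ` level n" if "g \<in> G" for g
    proof -
      obtain \<beta> where "g = tm \<beta>" using \<open>g \<in> G\<close> G_iff by blast
      then show ?thesis by (simp only: tm_def dom_level_pairs)
    qed
    with that show ?thesis by (simp add: Y_def VA_def vars_run_tree[OF assms])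
  qed
  \<comment> \<open>Only an inclusion, because \<open>Z\<close> also collects the variables of the
    other maps in \<open>G\<close>.\<close>
  have VB_sub: "VB \<beta> \<subseteq> Z \<union> Y" if "simulates \<B> \<rho> r \<beta> (Suc n)" for r \<beta>
  proof -
    have "leaf_sym (\<beta> v) \<in> \<Union> (ran (tm \<beta>))" if "length v = n" for v
      using that by (simp add: tm_def Union_ran_map_of_rel Range_level_pairs)
    moreover have "tm \<beta> \<in> G" using that G_iff by blast
    ultimately have "vars_trm (leaf_sym (\<beta> v)) \<subseteq> Z \<union> Y" if "length v = n" for v
      using that unfolding Z_def by blast
    moreover have "full_run \<B> r \<beta> n"
      using that by (simp add: full_run_iff_simulates[OF assms])
    moreover have "vars_fm (constraint \<B>) \<subseteq> Z \<union> Y" by (auto simp: Z_def)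
    ultimately show ?thesis by (simp add: VB_def vars_run_tree UN_subset_iff)
  qed
  \<comment> \<open>Two assignments are kept apart: entailment evaluates the terms of
    \<open>\<A>\<close> under the original one and those of \<open>\<B>\<close> under the modified
    one.\<close>
  define eqs where "eqs \<beta> c \<sigma> \<tau> \<longleftrightarrow> (\<forall>v. length v = n \<longrightarrow>
      eval M \<sigma> (leaf_sym (\<rho> v)) = of_real c * eval M \<tau> (leaf_sym (\<beta> v)))"
    for \<beta> :: "bool list \<Rightarrow> ('qb, ('f, 'x) trm) transition" and c :: real and \<sigma> \<tau>
  define sol where "sol g c \<sigma> \<longleftrightarrow> (\<forall>u1 U2. g u1 = Some U2 \<longrightarrow>
      (\<forall>u2\<in>U2. eval M \<sigma> u1 = of_real c * eval M \<sigma> u2))"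
    for g :: "('f, 'x) trm \<rightharpoonup> ('f, 'x) trm set" and c :: real and \<sigma>
  have sol_tm: "sol (tm \<beta>) c \<sigma> \<longleftrightarrow> eqs \<beta> c \<sigma> \<sigma>" for \<beta> c \<sigma>
    unfolding sol_def eqs_def tm_def by (rule all_map_of_rel_level_pairs)
  have evA: "eval M \<sigma> (leaf_sym (\<rho> v)) = eval M \<tau> (leaf_sym (\<rho> v))"
    if "length v = n" "\<And>x. x \<in> VA \<Longrightarrow> \<sigma> x = \<tau> x" for \<sigma> \<tau> v
    using that leaf_vars_run_tree[OF assms that(1)] by (intro eval_cong) (simp add: VA_def)
  have evB: "eval M \<sigma> (leaf_sym (\<beta> v)) = eval M \<tau> (leaf_sym (\<beta> v))"
    if "simulates \<B> \<rho> r \<beta> (Suc n)" "length v = n" "\<And>x. x \<in> VB \<beta> \<Longrightarrow> \<sigma> x = \<tau> x" for \<sigma> \<tau> v r \<beta>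
  proof -
    have "full_run \<B> r \<beta> n"
      using that by (simp add: full_run_iff_simulates[OF assms])
    then show ?thesis
      using that leaf_vars_run_tree[of \<B> r \<beta> n v] by (intro eval_cong) (simp add: VB_def)
  qed
  have eqs_cong: "eqs \<beta> c \<sigma> \<tau> \<longleftrightarrow> eqs \<beta> c \<sigma>' \<tau>'"
    if "simulates \<B> \<rho> r \<beta> (Suc n)" "\<And>x. x \<in> VA \<Longrightarrow> \<sigma> x = \<sigma>' x" "\<And>x. x \<in> VB \<beta> \<Longrightarrow> \<tau> x = \<tau>' x"
    for r \<beta> c \<sigma> \<tau> \<sigma>' \<tau>'
    using evA[OF _ that(2)] evB[OF that(1) _ that(3)] by (simp add: eqs_def)
  have satB: "sat M \<sigma> (constraint \<B>) = sat M \<tau> (constraint \<B>)"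
    if "\<And>x. x \<in> VB \<beta> \<Longrightarrow> \<sigma> x = \<tau> x" for \<sigma> \<tau> \<beta>
    using that by (intro sat_cong) (auto simp: VB_def)
  define wit where "wit \<sigma>Y \<tau> r \<beta> c \<longleftrightarrow> simulates \<B> \<rho> r \<beta> (Suc n) \<and> c \<noteq> 0 \<and>
      sat M (override_on \<sigma>Y \<tau> (VB \<beta> - VA)) (constraint \<B>) \<and>
      eqs \<beta> c \<sigma>Y (override_on \<sigma>Y \<tau> (VB \<beta> - VA))" for \<sigma>Y \<tau> r \<beta> c
  have wit_iff: "wit \<sigma>Y \<tau> r \<beta> c \<longleftrightarrow> c \<noteq> 0 \<and> sat M (override_on \<sigma>Y \<tau> Z) (constraint \<B>) \<and>
      sol (tm \<beta>) c (override_on \<sigma>Y \<tau> Z)" if sim: "simulates \<B> \<rho> r \<beta> (Suc n)" for \<sigma>Y \<tau> r \<beta> c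
  proof -
    have "G \<noteq> {}" using sim G_iff by blast
    then have Y: "Y = VA" by (rule Y_eq)
    \<comment> \<open>On \<open>VB \<beta>\<close> the sets \<open>VB \<beta> - VA\<close> and
      \<open>Z\<close> agree: variables in \<open>VA = Y\<close> are excluded from both, the others
      lie in both by \<open>VB_sub\<close>.\<close>
    have B: "override_on \<sigma>Y \<tau> (VB \<beta> - VA) x = override_on \<sigma>Y \<tau> Z x" if "x \<in> VB \<beta>" for x
      using that VB_sub[OF sim] Y by (auto simp: override_on_def Z_def)
    \<comment> \<open>\<open>Z\<close> avoids \<open>Y\<close>, so the query evaluates the terms of
      \<open>\<A>\<close> as \<open>\<sigma>Y\<close> does.\<close>
    have A: "\<sigma>Y x = override_on \<sigma>Y \<tau> Z x" if "x \<in> VA" for x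
      using that Y by (auto simp: override_on_def Z_def)
    have "sat M (override_on \<sigma>Y \<tau> (VB \<beta> - VA)) (constraint \<B>) \<longleftrightarrow>
        sat M (override_on \<sigma>Y \<tau> Z) (constraint \<B>)"
      using B by (rule satB)
    moreover have "eqs \<beta> c \<sigma>Y (override_on \<sigma>Y \<tau> (VB \<beta> - VA)) \<longleftrightarrow>
        eqs \<beta> c (override_on \<sigma>Y \<tau> Z) (override_on \<sigma>Y \<tau> Z)"
      using sim A B by (rule eqs_cong)
    ultimately show ?thesis using sim by (simp add: wit_def sol_tm)
  qed
  have query: "(\<exists>\<sigma>Z. sat M (override_on \<sigma>Y \<sigma>Z Z) (constraint \<B>) \<and>
      (\<exists>g\<in>G. \<exists>c::real. c \<noteq> 0 \<and> sol g c (override_on \<sigma>Y \<sigma>Z Z))) \<longleftrightarrow>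
    (\<exists>\<tau> r \<beta> c. wit \<sigma>Y \<tau> r \<beta> c)" (is "?L \<longleftrightarrow> ?R") for \<sigma>Y
  proof
    assume ?L
    then obtain \<tau> g c where g: "g \<in> G" and w: "c \<noteq> 0" "sat M (override_on \<sigma>Y \<tau> Z) (constraint \<B>)"
      "sol g c (override_on \<sigma>Y \<tau> Z)" by blast
    obtain r \<beta> where sim: "simulates \<B> \<rho> r \<beta> (Suc n)" and "g = tm \<beta>"
      using g G_iff by blast
    with w have "wit \<sigma>Y \<tau> r \<beta> c" by (simp add: wit_iff)
    then show ?R by blast
  next
    assume ?R
    then obtain \<tau> r \<beta> c where w: "wit \<sigma>Y \<tau> r \<beta> c" by blast
    then have sim: "simulates \<B> \<rho> r \<beta> (Suc n)" by (simp add: wit_def)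
    then have "tm \<beta> \<in> G" using G_iff by blast
    with w show ?L unfolding wit_iff[OF sim] by blast
  qed
  have eval_eq: "eval_tree M \<sigma>Y (run_tree \<rho> n) = scale_tree c (eval_tree M \<sigma> (run_tree \<beta> m)) \<longleftrightarrow>
      n = m \<and> (\<forall>v. length v \<le> n \<longrightarrow> compatible (\<rho> v) (\<beta> v)) \<and> eqs \<beta> c \<sigma>Y \<sigma>"
    if "full_run \<B> r \<beta> m" for \<sigma>Y \<sigma> r \<beta> m c
    unfolding eqs_def using eval_run_tree_eq_iff[OF assms that] .
  have entail: "(\<exists>TB\<in>language \<B>. \<exists>\<sigma>B. \<exists>c::real. c \<noteq> 0 \<and>
        sat M (override_on \<sigma>Y \<sigma>B (vars_tree TB \<union> vars_fm (constraint \<B>) - VA)) (constraint \<B>) \<and>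
        eval_tree M \<sigma>Y (run_tree \<rho> n) = scale_tree c (eval_tree M
          (override_on \<sigma>Y \<sigma>B (vars_tree TB \<union> vars_fm (constraint \<B>) - VA)) TB)) \<longleftrightarrow>
    (\<exists>\<tau> r \<beta> c. wit \<sigma>Y \<tau> r \<beta> c)" (is "?L \<longleftrightarrow> ?R") for \<sigma>Y
  proof
    assume ?L
    then obtain TB \<tau> and c :: real where TB: "TB \<in> language \<B>" and c: "c \<noteq> 0"
      and sat: "sat M (override_on \<sigma>Y \<tau> (vars_tree TB \<union> vars_fm (constraint \<B>) - VA)) (constraint \<B>)"
      and eq: "eval_tree M \<sigma>Y (run_tree \<rho> n) = scale_tree c (eval_tree M
          (override_on \<sigma>Y \<tau> (vars_tree TB \<union> vars_fm (constraint \<B>) - VA)) TB)"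
      by blast
    obtain r \<beta> m where r: "r \<in> roots \<B>" and run: "full_run \<B> r \<beta> m" and "TB = run_tree \<beta> m"
      using TB unfolding language_iff by blast
    \<comment> \<open>Equality of the trees forces height \<open>n\<close> and matching symbols,
      which makes \<open>\<beta>\<close> a simulation of \<open>\<rho>\<close>.\<close>
    with eq sat have e: "n = m" "\<forall>v. length v \<le> n \<longrightarrow> compatible (\<rho> v) (\<beta> v)"
        "eqs \<beta> c \<sigma>Y (override_on \<sigma>Y \<tau> (VB \<beta> - VA))"
        "sat M (override_on \<sigma>Y \<tau> (VB \<beta> - VA)) (constraint \<B>)"
      by (simp_all add: eval_eq VB_def)
    then have "simulates \<B> \<rho> r \<beta> (Suc n)"
      unfolding full_run_iff_simulates[OF assms] using r run by simp
    then have "wit \<sigma>Y \<tau> r \<beta> c"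
      using c e by (simp add: wit_def)
    then show ?R by blast
  next
    assume ?R
    then obtain \<tau> r \<beta> c where w: "wit \<sigma>Y \<tau> r \<beta> c" by blast
    then have run: "r \<in> roots \<B>" "full_run \<B> r \<beta> n" "\<forall>v. length v \<le> n \<longrightarrow> compatible (\<rho> v) (\<beta> v)"
      by (simp_all add: wit_def full_run_iff_simulates[OF assms])
    then have "run_tree \<beta> n \<in> language \<B>" unfolding language_iff by blast
    moreover have "eval_tree M \<sigma>Y (run_tree \<rho> n) =
        scale_tree c (eval_tree M (override_on \<sigma>Y \<tau> (VB \<beta> - VA)) (run_tree \<beta> n))"
      using w run by (simp add: eval_eq wit_def)
    ultimately show ?L using w unfolding wit_def VB_def by blast
  qed
  show ?thesis
    unfolding query_valid_def entails_tree_def Let_def G_def[symmetric] Y_def[symmetric]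
      Z_def[symmetric] VA_def[symmetric] sol_def[symmetric] query entail ..
qed


section \<open>The exploration\<close>

text \<open>The exploration as a graph, freed from the bookkeeping of processed and work
  sets.\<close>

definition config_step ::
  "('qa, 'p, 'f, 'x) lsta \<Rightarrow> ('qb, 'p, 'f, 'x) lsta \<Rightarrow>
   'qa set \<times> ('qa, 'qb, ('f, 'x) trm) mappings \<Rightarrow>
   'qa set \<times> ('qa, 'qb, ('f, 'x) trm) mappings \<Rightarrow> bool" where
  "config_step \<A> \<B> X X' \<longleftrightarrow> fst X \<noteq> {} \<and> X' \<in> successor \<B> (snd X) ` feas \<A> (fst X)"

definition start :: "('qb, 'p, 'f, 'x) lsta \<Rightarrow> 'qa \<Rightarrow> 'qa set \<times> ('qa, 'qb, ('f, 'x) trm) mappings" where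
  "start \<B> q = ({q}, {([q \<mapsto> {r}], Map.empty) | r. r \<in> roots \<B>})"

text \<open>The certificate that a positive answer leaves behind.\<close>

definition explored ::
  "('p, 'f) interp \<Rightarrow> ('qa, 'p, 'f, 'x) lsta \<Rightarrow> ('qb, 'p, 'f, 'x) lsta \<Rightarrow>
   ('qa set \<times> ('qa, 'qb, ('f, 'x) trm) mappings) set \<Rightarrow> bool" where
  "explored M \<A> \<B> S \<longleftrightarrow> (\<forall>X\<in>S. \<forall>X'. config_step \<A> \<B> X X' \<longrightarrow> X' \<in> S) \<and>
     (\<forall>F. ({}, F) \<in> S \<longrightarrow> query_valid M \<A> \<B> F)"

text \<open>The last two assumptions are the loop invariant: no successor of a processed
  configuration is lost, and processed queries are valid. When the work set is empty, the processed
  set itself serves as \<open>S\<close>.\<close>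

lemma entail_loop_True:
  assumes "entail_loop M \<A> \<B> processed workset res" "res"
    and "\<And>X X'. X \<in> processed \<Longrightarrow> config_step \<A> \<B> X X' \<Longrightarrow> X' \<in> processed \<union> workset"
    and "\<And>F. ({}, F) \<in> processed \<Longrightarrow> query_valid M \<A> \<B> F"
  shows "\<exists>S. processed \<union> workset \<subseteq> S \<and> explored M \<A> \<B> S"
  using assms
proof (induction rule: entail_loop.induct)
  case (finished processed)
  have "explored M \<A> \<B> processed"
    using finished.prems(2,3) unfolding explored_def Un_empty_right by blast
  then show ?case by (intro exI[of _ processed]) simp
next
  case (refuted F workset processed)
  from refuted.prems(1) show ?case by simp
next
  case (confirmed F workset processed res)
  have "\<exists>S. insert ({}, F) processed \<union> (workset - {({}, F)}) \<subseteq> S \<and> explored M \<A> \<B> S"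
  proof (rule confirmed.IH)
    \<comment> \<open>The new element has no states and hence no successors, so only old elements
      matter.\<close>
    fix X X' assume "X \<in> insert ({}, F) processed" "config_step \<A> \<B> X X'"
    then show "X' \<in> insert ({}, F) processed \<union> (workset - {({}, F)})"
      using confirmed.prems(2)[of X X'] by (auto simp: config_step_def)
  qed (use confirmed.hyps(2) confirmed.prems(1,3) in auto)
  then obtain S where "insert ({}, F) processed \<union> (workset - {({}, F)}) \<subseteq> S" "explored M \<A> \<B> S"
    by (elim exE conjE)
  then show ?case by (intro exI[of _ S]) auto
next
  case (expanded D F workset processed' processed workset' res)
  have "\<exists>S. processed' \<union> workset' \<subseteq> S \<and> explored M \<A> \<B> S"
  proof (rule expanded.IH)
    fix X X' assume "X \<in> processed'" "config_step \<A> \<B> X X'"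
    then show "X' \<in> processed' \<union> workset'"
      using expanded.hyps(3,4) expanded.prems(2)[of X X'] by (auto simp: config_step_def)
  qed (use expanded.hyps(2,3) expanded.prems(1,3) in auto)
  then obtain S where "processed' \<union> workset' \<subseteq> S" "explored M \<A> \<B> S"
    by (elim exE conjE)
  then show ?case using expanded.hyps(3,4) by (intro exI[of _ S]) auto
qed

text \<open>Traces the failing query back through the execution: each element of a later work set
  was there before or is a successor of the element just removed.\<close>

lemma entail_loop_False:
  assumes "entail_loop M \<A> \<B> processed workset res" "\<not> res"
  shows "\<exists>X\<in>workset. \<exists>F. (config_step \<A> \<B>)\<^sup>*\<^sup>* X ({}, F) \<and> \<not> query_valid M \<A> \<B> F"
  using assms
proof (induction rule: entail_loop.induct)
  case (finished processed)
  from finished.prems show ?case by simp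
next
  case (refuted F workset processed)
  from refuted.hyps show ?case by blast
next
  case (confirmed F workset processed res)
  from confirmed.IH[OF confirmed.prems] show ?case by blast
next
  case (expanded D F workset processed' processed workset' res)
  from expanded.IH[OF expanded.prems]
  obtain X F' where X: "X \<in> workset'" "(config_step \<A> \<B>)\<^sup>*\<^sup>* X ({}, F')" "\<not> query_valid M \<A> \<B> F'"
    by (elim bexE exE conjE)
  show ?case
  proof (cases "X \<in> workset")
    case True
    with X(2,3) show ?thesis by blast
  next
    case False
    then have "config_step \<A> \<B> (D, F) X"
      using X(1) expanded.hyps(2,4) by (auto simp: config_step_def)
    then have "(config_step \<A> \<B>)\<^sup>*\<^sup>* (D, F) ({}, F')"
      using X(2) by (rule converse_rtranclp_into_rtranclp)
    with expanded.hyps(1) X(3) show ?thesis by (intro bexI[of _ "(D, F)"] exI[of _ F'] conjI)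
  qed
qed

section \<open>From runs to explored configurations\<close>

lemma config_step_level:
  assumes "is_lsta \<A>" "level_ok \<A> q \<rho> i"
  shows "config_step \<A> \<B> (state_at q \<rho> ` level i, F) (successor \<B> F (\<rho> ` level i))"
proof -
  have "\<rho> ` level i \<in> feas \<A> (state_at q \<rho> ` level i)"
    using feas_iff_level[OF assms(1)] assms(2) by blast
  then show ?thesis by (simp add: config_step_def level_nonempty)
qed

lemma full_run_reaches:
  assumes "is_lsta \<A>" "is_lsta \<B>" "full_run \<A> q \<rho> n"
  shows "(config_step \<A> \<B>)\<^sup>*\<^sup>* (start \<B> q) ({}, final_mappings \<B> \<rho> n)"
proof -
  have ok: "level_ok \<A> q \<rho> i" if "i \<le> n" for i
    using assms(3) that by (simp add: full_run_def)
  have "(config_step \<A> \<B>)\<^sup>*\<^sup>* (start \<B> q) (state_at q \<rho> ` level i, mappings_at \<B> q \<rho> i)"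
    if "i \<le> n" for i
    using that
  proof (induction i)
    case 0
    show ?case by (simp add: start_def mappings_at_0 level_0)
  next
    case (Suc i)
    have "config_step \<A> \<B> (state_at q \<rho> ` level i, mappings_at \<B> q \<rho> i)
        (state_at q \<rho> ` level (Suc i), mappings_at \<B> q \<rho> (Suc i))"
      using config_step_level[OF assms(1) ok, of i \<B> "mappings_at \<B> q \<rho> i"] Suc.prems
        successor_internal[OF assms(1,2) ok, of i] assms(3) by (simp add: full_run_def)
    with Suc show ?case by (simp add: rtranclp.rtrancl_into_rtrancl)
  qed
  from this[of n]
  have "(config_step \<A> \<B>)\<^sup>*\<^sup>* (start \<B> q) (state_at q \<rho> ` level n, mappings_at \<B> q \<rho> n)" by simp
  moreover have "config_step \<A> \<B> (state_at q \<rho> ` level n, mappings_at \<B> q \<rho> n)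
      ({}, final_mappings \<B> \<rho> n)"
    using config_step_level[OF assms(1) ok, of n \<B> "mappings_at \<B> q \<rho> n"]
      successor_leaf[OF assms(1,2) ok, of n] assms(3) by (simp add: full_run_def)
  ultimately show ?thesis by (rule rtranclp.rtrancl_into_rtrancl)
qed

section \<open>From explored configurations to runs\<close>

lemma config_step_imp_level_step:
  assumes "config_step \<A> \<B> X X'"
  shows "level_step \<A> (fst X) (fst X')"
  using assms by (auto simp: config_step_def level_step_def successor_def)

definition run_prefix ::
  "('q, 'p, 'f, 'x) lsta \<Rightarrow> 'q \<Rightarrow> (bool list \<Rightarrow> ('q, ('f, 'x) trm) transition) \<Rightarrow> nat \<Rightarrow> bool" where
  "run_prefix \<C> q \<rho> i \<longleftrightarrow>
     (\<forall>j<i. level_ok \<C> q \<rho> j) \<and> (\<forall>v. length v < i \<longrightarrow> is_Internal (\<rho> v))"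

text \<open>The path is either still among internal levels or completed by a leaf level. The
  conjunct on \<open>level_step\<close> keeps the reachability from the root that
  \<open>level_uniform\<close> asks for.\<close>

definition along_run ::
  "('qa, 'p, 'f, 'x) lsta \<Rightarrow> ('qb, 'p, 'f, 'x) lsta \<Rightarrow> 'qa \<Rightarrow>
   'qa set \<times> ('qa, 'qb, ('f, 'x) trm) mappings \<Rightarrow> bool" where
  "along_run \<A> \<B> q X \<longleftrightarrow> (level_step \<A>)\<^sup>*\<^sup>* {q} (fst X) \<and>
    ((\<exists>\<rho> i. run_prefix \<A> q \<rho> i \<and> X = (state_at q \<rho> ` level i, mappings_at \<B> q \<rho> i)) \<or>
     (\<exists>\<rho> n. full_run \<A> q \<rho> n \<and> X = ({}, final_mappings \<B> \<rho> n)))"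

text \<open>Reachability of the empty set passes backwards along a step, so the induction hypothesis
  applies to the predecessor. The feasible set of the step then lies on a path from the root to the
  empty set, and level uniformity makes it purely internal, which extends the prefix, or purely
  leaf, which completes the run.\<close>

lemma reached_along_run:
  assumes "is_lsta \<A>" "is_lsta \<B>" "level_uniform \<A>" "q \<in> roots \<A>"
    and "(config_step \<A> \<B>)\<^sup>*\<^sup>* (start \<B> q) X"
  shows "(level_step \<A>)\<^sup>*\<^sup>* (fst X) {} \<Longrightarrow> along_run \<A> \<B> q X"
  using assms(5)
proof (induction X rule: rtranclp_induct)
  case base
  \<comment> \<open>With no levels to check, any function is a prefix.\<close>
  have "run_prefix \<A> q undefined 0"
    by (simp add: run_prefix_def)
  moreover have "start \<B> q = (state_at q undefined ` level 0, mappings_at \<B> q undefined 0)"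
    by (simp add: start_def mappings_at_0 level_0)
  moreover have "fst (start \<B> q) = {q}"
    by (simp add: start_def)
  ultimately show ?case
    unfolding along_run_def by (metis rtranclp.rtrancl_refl)
next
  case (step X X')
  have ls: "level_step \<A> (fst X) (fst X')"
    using step.hyps(2) by (rule config_step_imp_level_step)
  then have "(level_step \<A>)\<^sup>*\<^sup>* (fst X) {}"
    using step.prems by (rule converse_rtranclp_into_rtranclp)
  then have "along_run \<A> \<B> q X" by (rule step.IH)
  note IH = this[unfolded along_run_def]
  have q': "(level_step \<A>)\<^sup>*\<^sup>* {q} (fst X')"
    using conjunct1[OF IH] ls by (rule rtranclp.rtrancl_into_rtrancl)
  have "fst X \<noteq> {}" using step.hyps(2) by (simp add: config_step_def)
  \<comment> \<open>A completed run has no states left and admits no step, so \<open>X\<close> comes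
    from a prefix.\<close>
  then obtain \<rho> i where "run_prefix \<A> q \<rho> i"
    and X: "X = (state_at q \<rho> ` level i, mappings_at \<B> q \<rho> i)"
    using IH by auto
  then have pre: "\<forall>j<i. level_ok \<A> q \<rho> j" "\<forall>v. length v < i \<longrightarrow> is_Internal (\<rho> v)"
    by (simp_all add: run_prefix_def)
  obtain \<Gamma> where \<Gamma>: "\<Gamma> \<in> feas \<A> (state_at q \<rho> ` level i)" and X': "X' = successor \<B> (mappings_at \<B> q \<rho> i) \<Gamma>"
    using step.hyps(2) X by (auto simp: config_step_def)
  \<comment> \<open>\<open>\<Gamma>\<close> becomes level \<open>i\<close> of the run; the mappings
    so far depend only on earlier levels and stay the same.\<close>
  obtain \<rho>' where \<rho>': "\<And>v. length v < i \<Longrightarrow> \<rho>' v = \<rho> v" "level_ok \<A> q \<rho>' i" "\<Gamma> = \<rho>' ` level i"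
    using \<Gamma> unfolding feas_iff_level[OF assms(1)] by blast
  have "mappings_at \<B> q \<rho>' i = mappings_at \<B> q \<rho> i"
    using \<rho>'(1) by (rule mappings_at_cong)
  with X' \<rho>'(3) have X'_eq: "X' = successor \<B> (mappings_at \<B> q \<rho>' i) (\<rho>' ` level i)" by simp
  have "level_ok \<A> q \<rho>' j" if "j < i" for j
    using pre(1) that \<rho>'(1) level_ok_cong[of j \<rho>' \<rho> \<A> q] by simp
  then have ok: "level_ok \<A> q \<rho>' j" if "j \<le> i" for j
    using \<rho>'(2) that by (cases "j = i") auto
  have int: "is_Internal (\<rho>' v)" if "length v < i" for v
    using pre(2) \<rho>'(1) that by simp
  have "(level_step \<A>)\<^sup>*\<^sup>* {q} (state_at q \<rho> ` level i)"
    using conjunct1[OF IH] by (simp add: X)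
  \<comment> \<open>The bottom states of \<open>\<Gamma>\<close> are the states of
    \<open>X'\<close>, from which the empty set is reachable by assumption.\<close>
  moreover have "(level_step \<A>)\<^sup>*\<^sup>* (\<Union>\<delta>\<in>\<Gamma>. bot_of \<delta>) {}"
    using step.prems by (simp add: X' successor_def)
  ultimately have "(\<forall>\<delta>\<in>\<Gamma>. is_Internal \<delta>) \<or> (\<forall>\<delta>\<in>\<Gamma>. is_Leaf \<delta>)"
    using assms(3,4) \<Gamma> unfolding level_uniform_def by blast
  then consider "\<And>v. length v = i \<Longrightarrow> is_Internal (\<rho>' v)" | "\<And>v. length v = i \<Longrightarrow> is_Leaf (\<rho>' v)"
    using \<rho>'(3) by auto
  then show ?case
  proof cases
    case 1
    have "X' = (state_at q \<rho>' ` level (Suc i), mappings_at \<B> q \<rho>' (Suc i))"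
      using successor_internal[OF assms(1,2) \<rho>'(2) 1] X'_eq by simp
    moreover have "run_prefix \<A> q \<rho>' (Suc i)"
      using ok int 1 by (auto simp: run_prefix_def less_Suc_eq)
    ultimately show ?thesis using q' unfolding along_run_def by blast
  next
    case 2
    have "X' = ({}, final_mappings \<B> \<rho>' i)"
      using successor_leaf[OF assms(1,2) \<rho>'(2) 2] X'_eq by simp
    moreover have "full_run \<A> q \<rho>' i" using ok int 2 by (simp add: full_run_def)
    ultimately show ?thesis using q' unfolding along_run_def by blast
  qed
qed

text \<open>A positive answer is sound because every run of \<open>\<A>\<close> leads to an explored
  query. A negative answer refutes entailment once the failing query stems from a run, which
  \<open>level_uniform\<close> ensures. Termination is part of \<open>entail_returns\<close>, whose
  derivations are finite executions with any order of removal.\<close>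

theorem theorem1:
  fixes M :: "('p, 'f) interp"
    and \<A> :: "('qa, 'p, 'f, 'x) lsta"
    and \<B> :: "('qb, 'p, 'f, 'x) lsta"
    and res :: bool
  assumes "is_lsta \<A>" and "is_lsta \<B>"
    and "entail_returns M \<A> \<B> res"
  shows "(level_uniform \<A> \<longrightarrow> (res \<longleftrightarrow> entails_sc M \<A> \<B>)) \<and> (res \<longrightarrow> entails_sc M \<A> \<B>)"
proof -
  define W :: "('qa set \<times> ('qa, 'qb, ('f, 'x) trm) mappings) set" where "W = start \<B> ` roots \<A>"
  have "{({q}, {([q \<mapsto> {r}], Map.empty) | r. r \<in> roots \<B>}) | q. q \<in> roots \<A>} = W"
    by (auto simp: W_def start_def)
  then have loop: "entail_loop M \<A> \<B> {} W res"
    using assms(3) by (simp add: entail_returns_def)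
  have sound: "entails_sc M \<A> \<B>" if res: "res"
  proof -
    obtain S where S: "W \<subseteq> S" "\<And>X X'. X \<in> S \<Longrightarrow> config_step \<A> \<B> X X' \<Longrightarrow> X' \<in> S"
      "\<And>F. ({}, F) \<in> S \<Longrightarrow> query_valid M \<A> \<B> F"
      using entail_loop_True[OF loop res] by (auto simp: explored_def)
    have closed: "X' \<in> S" if "(config_step \<A> \<B>)\<^sup>*\<^sup>* X X'" "X \<in> S" for X X'
      using that by (induction rule: rtranclp_induct) (auto intro: S(2))
    have "entails_tree M \<A> \<B> (run_tree \<rho> n)" if "q \<in> roots \<A>" "full_run \<A> q \<rho> n" for q \<rho> n
    proof -
      have "start \<B> q \<in> S" using S(1) that(1) by (auto simp: W_def)
      then have "({}, final_mappings \<B> \<rho> n) \<in> S"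
        using closed full_run_reaches[OF assms(1,2) that(2)] by blast
      then show ?thesis using S(3) query_valid_final[OF that(2)] by blast
    qed
    then show ?thesis by (auto simp: entails_sc_iff language_iff)
  qed
  have complete: "\<not> entails_sc M \<A> \<B>" if uniform: "level_uniform \<A>" and refuted: "\<not> res"
  proof -
    obtain q F where q: "q \<in> roots \<A>" and reach: "(config_step \<A> \<B>)\<^sup>*\<^sup>* (start \<B> q) ({}, F)"
      and invalid: "\<not> query_valid M \<A> \<B> F"
      using entail_loop_False[OF loop refuted] by (auto simp: W_def)
    \<comment> \<open>The failing configuration has no states while every level has some, so it can
      only stem from a completed run.\<close>
    have "\<not> ({}, F) = (state_at q \<rho> ` level i, mappings_at \<B> q \<rho> i)" for \<rho> i
      using level_nonempty by auto
    then obtain \<rho> n where run: "full_run \<A> q \<rho> n" and F: "F = final_mappings \<B> \<rho> n"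
      using reached_along_run[OF assms(1,2) uniform q reach] by (auto simp: along_run_def)
    then have "\<not> entails_tree M \<A> \<B> (run_tree \<rho> n)"
      using invalid query_valid_final[OF run, of M \<B>] by (simp add: F)
    moreover have "run_tree \<rho> n \<in> language \<A>"
      using q run by (auto simp: language_iff)
    ultimately show ?thesis by (auto simp: entails_sc_iff)
  qed
  show ?thesis using sound complete by blast
qed

end
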